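(* Assume that $\nu>0$, and that for every $(t,x)\in[0,T]\times\mathbb{T}^2$ the functions $F(t,x,\cdot)$ and $G(x,\cdot)$ are convex and continuous for $\rho\ge 0$ and differentiable for $\rho>0$, with $\partial_\rho F=f$ and $\partial_\rho G=g$. Then the discrete mean-field game system $$\begin{cases}-(D_t\phi_{ij})^k-\nu(\Delta_h\phi^k)_{ij}+H_h(t_k,x_{ij},[D_h\phi^k]_{ij},\rho^{k+1}_{ij})=f(t_k,x_{ij},\rho^{k+1}_{ij}),\\(D_t\rho_{ij})^k-\nu(\Delta_h\rho^{k+1})_{ij}-\mathcal{B}_{ij}(t_k,\phi^k,\rho^{k+1},\rho^{k+1})=0,\\ \rho^0_{ij}=(\rho_0)_{ij},\quad\phi^{N_T}_{ij}=g(x_{ij},\rho^{N_T}_{ij}),\end{cases}\qquad 0\le i,j\le N_h-1,\ 0\le k\le N_T-1,$$ admits a solution $(\phi,\rho)$, with $\phi=(\phi^k_{ij})$ and $\rho=(\rho^k_{ij})$, $0\le k\le N_T$.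
   Context: $\mathbb{T}^2=\mathbb{R}^2/\mathbb{Z}^2$; $T>0$; $h,\Delta t>0$ with $N_h=1/h\in\mathbb{N}$, $N_T=T/\Delta t\in\mathbb{N}$; $x_{ij}=(ih,jh)$, $t_k=k\Delta t$; spatial indices are taken modulo $N_h$. Fixed parameters: $\epsilon>0$, $1<\beta\le 2$, $0<\alpha\le\frac{4(\beta-1)}{\beta}$. $\rho_0\ge0$ is a probability density on $\mathbb{T}^2$ and $(\rho_0)_{ij}=\frac1{h^2}\int_{\|x-x_{ij}\|_\infty\le h/2}\rho_0(x)\,dx$, so $\sum_{i,j}(\rho_0)_{ij}=1/h^2$. Difference operators: $(D_1u)_{ij}=\frac{u_{(i+1)j}-u_{ij}}h$, $(D_2u)_{ij}=\frac{u_{i(j+1)}-u_{ij}}h$, $[D_hu]_{ij}=\big((D_1u)_{ij},(D_1u)_{(i-1)j},(D_2u)_{ij},(D_2u)_{i(j-1)}\big)$, $(\Delta_hu)_{ij}=\frac{u_{(i-1)j}+u_{(i+1)j}+u_{i(j-1)}+u_{i(j+1)}-4u_{ij}}{4h^2}$, $(D_tu_{ij})^k=\frac{u^{k+1}_{ij}-u^k_{ij}}{\Delta t}$. With $q^+=\max(q,0)$, $q^-=\max(-q,0)$, the discrete Hamiltonian is $$H_h(t,x,q_1,q_2,q_3,q_4,\eta)=\frac{((q_1^-)^2+(q_2^+)^2+(q_3^-)^2+(q_4^+)^2)^{\beta/2}}{\beta(\eta+\epsilon)^\alpha},\qquad\eta\ge0.$$ Writing $P^m_{ij}=\rho_{ij}\,\partial_{q_m}H_h(t,x_{ij},[D_h\phi]_{ij},\eta_{ij})$,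 $1\le m\le4$, $$\mathcal{B}_{ij}(t,\phi,\rho,\eta)=\frac1h\Big[(P^1_{ij}-P^1_{(i-1)j})+(P^2_{(i+1)j}-P^2_{ij})+(P^3_{ij}-P^3_{i(j-1)})+(P^4_{i(j+1)}-P^4_{ij})\Big].$$ $F:[0,T]\times\mathbb{T}^2\times[0,\infty)\to\mathbb{R}$ and $G:\mathbb{T}^2\times[0,\infty)\to\mathbb{R}$. Since $f=\partial_\rho F$, $g=\partial_\rho G$ are only assumed to exist for $\rho>0$, the system is understood for $\rho$ with $\rho^{k+1}_{ij}>0$ for all $0\le k\le N_T-1$ and all $i,j$. *)

theory Defs
  imports "HOL-Analysis.Analysis"
begin

text \<open>Functions on the torus \<open>\<real>\<^sup>2/\<int>\<^sup>2\<close> are represented by their \<open>\<int>\<^sup>2\<close>-periodic lifts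
  to \<open>\<real> \<times> \<real>\<close>.\<close>

definition torus_fun :: "(real \<times> real \<Rightarrow> 'a) \<Rightarrow> bool" where
  "torus_fun u \<longleftrightarrow> (\<forall>x y. u (x + 1, y) = u (x, y) \<and> u (x, y + 1) = u (x, y))"

definition torus_prob_density :: "(real \<times> real \<Rightarrow> real) \<Rightarrow> bool" where
  "torus_prob_density r \<longleftrightarrow>
     torus_fun r \<and> (\<forall>x. 0 \<le> r x) \<and>
     set_integrable lebesgue ({0..1} \<times> {0..1}) r \<and>
     (LINT x : {0..1} \<times> {0..1} | lebesgue. r x) = 1"

text \<open>Grid functions on the discrete torus with \<open>N\<close> points per direction: the spatial indices
  run over \<open>int\<close>, and reading them modulo \<open>N\<close> is expressed by periodicity.\<close>

type_synonym grid_fun = "int \<Rightarrow> int \<Rightarrow> real"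

definition grid_periodic :: "nat \<Rightarrow> grid_fun \<Rightarrow> bool" where
  "grid_periodic N u \<longleftrightarrow>
     (\<forall>i j. u (i + int N) j = u i j \<and> u i (j + int N) = u i j)"

definition grid_point :: "real \<Rightarrow> int \<Rightarrow> int \<Rightarrow> real \<times> real" where
  "grid_point h i j = (of_int i * h, of_int j * h)"

definition cell_average :: "real \<Rightarrow> (real \<times> real \<Rightarrow> real) \<Rightarrow> grid_fun" where
  "cell_average h r i j =
     1 / h\<^sup>2 *
     (LINT x : {x. max \<bar>fst x - fst (grid_point h i j)\<bar> \<bar>snd x - snd (grid_point h i j)\<bar> \<le> h / 2}
        | lebesgue. r x)"

definition D1 :: "real \<Rightarrow> grid_fun \<Rightarrow> grid_fun" where
  "D1 h u i j = (u (i + 1) j - u i j) / h"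

definition D2 :: "real \<Rightarrow> grid_fun \<Rightarrow> grid_fun" where
  "D2 h u i j = (u i (j + 1) - u i j) / h"

definition discrete_laplacian :: "real \<Rightarrow> grid_fun \<Rightarrow> grid_fun" where
  "discrete_laplacian h u i j =
     (u (i - 1) j + u (i + 1) j + u i (j - 1) + u i (j + 1) - 4 * u i j) / (4 * h\<^sup>2)"

definition Dt :: "real \<Rightarrow> (nat \<Rightarrow> grid_fun) \<Rightarrow> nat \<Rightarrow> grid_fun" where
  "Dt dt u k i j = (u (Suc k) i j - u k i j) / dt"

type_synonym hamiltonian =
  "real \<Rightarrow> real \<times> real \<Rightarrow> real \<Rightarrow> real \<Rightarrow> real \<Rightarrow> real \<Rightarrow> real \<Rightarrow> real"

definition congestion_hamiltonian :: "real \<Rightarrow> real \<Rightarrow> real \<Rightarrow> hamiltonian" where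
  "congestion_hamiltonian \<epsilon> \<alpha> \<beta> t x q1 q2 q3 q4 \<eta> =
     ((max (- q1) 0)\<^sup>2 + (max q2 0)\<^sup>2 + (max (- q3) 0)\<^sup>2 + (max q4 0)\<^sup>2) powr (\<beta> / 2)
       / (\<beta> * (\<eta> + \<epsilon>) powr \<alpha>)"

text \<open>\<open>on_Dh h u f i j\<close> is \<open>f\<close> evaluated at the vector \<open>[D\<^sub>h u]\<^sub>i\<^sub>j\<close>.\<close>

definition on_Dh :: "real \<Rightarrow> grid_fun \<Rightarrow> (real \<Rightarrow> real \<Rightarrow> real \<Rightarrow> real \<Rightarrow> 'a) \<Rightarrow> int \<Rightarrow> int \<Rightarrow> 'a" where
  "on_Dh h u f i j = f (D1 h u i j) (D1 h u (i - 1) j) (D2 h u i j) (D2 h u i (j - 1))"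

definition P1 :: "hamiltonian \<Rightarrow> real \<Rightarrow> real \<Rightarrow> grid_fun \<Rightarrow> grid_fun \<Rightarrow> grid_fun \<Rightarrow> grid_fun" where
  "P1 H h t \<phi> \<rho> \<eta> i j = \<rho> i j *
     on_Dh h \<phi> (\<lambda>q1 q2 q3 q4. deriv (\<lambda>q. H t (grid_point h i j) q q2 q3 q4 (\<eta> i j)) q1) i j"

definition P2 :: "hamiltonian \<Rightarrow> real \<Rightarrow> real \<Rightarrow> grid_fun \<Rightarrow> grid_fun \<Rightarrow> grid_fun \<Rightarrow> grid_fun" where
  "P2 H h t \<phi> \<rho> \<eta> i j = \<rho> i j *
     on_Dh h \<phi> (\<lambda>q1 q2 q3 q4. deriv (\<lambda>q. H t (grid_point h i j) q1 q q3 q4 (\<eta> i j)) q2) i j"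

definition P3 :: "hamiltonian \<Rightarrow> real \<Rightarrow> real \<Rightarrow> grid_fun \<Rightarrow> grid_fun \<Rightarrow> grid_fun \<Rightarrow> grid_fun" where
  "P3 H h t \<phi> \<rho> \<eta> i j = \<rho> i j *
     on_Dh h \<phi> (\<lambda>q1 q2 q3 q4. deriv (\<lambda>q. H t (grid_point h i j) q1 q2 q q4 (\<eta> i j)) q3) i j"

definition P4 :: "hamiltonian \<Rightarrow> real \<Rightarrow> real \<Rightarrow> grid_fun \<Rightarrow> grid_fun \<Rightarrow> grid_fun \<Rightarrow> grid_fun" where
  "P4 H h t \<phi> \<rho> \<eta> i j = \<rho> i j *
     on_Dh h \<phi> (\<lambda>q1 q2 q3 q4. deriv (\<lambda>q. H t (grid_point h i j) q1 q2 q3 q (\<eta> i j)) q4) i j"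

definition transport_op ::
  "hamiltonian \<Rightarrow> real \<Rightarrow> real \<Rightarrow> grid_fun \<Rightarrow> grid_fun \<Rightarrow> grid_fun \<Rightarrow> grid_fun" where
  "transport_op H h t \<phi> \<rho> \<eta> i j =
     1 / h *
     ((P1 H h t \<phi> \<rho> \<eta> i j - P1 H h t \<phi> \<rho> \<eta> (i - 1) j) +
      (P2 H h t \<phi> \<rho> \<eta> (i + 1) j - P2 H h t \<phi> \<rho> \<eta> i j) +
      (P3 H h t \<phi> \<rho> \<eta> i j - P3 H h t \<phi> \<rho> \<eta> i (j - 1)) +
      (P4 H h t \<phi> \<rho> \<eta> i (j + 1) - P4 H h t \<phi> \<rho> \<eta> i j))"

text \<open>Positivity of \<open>\<rho>\<close> at the times \<open>1, \<dots>, N\<^sub>T\<close> is part of being a solution, since \<open>f\<close> and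
  \<open>g\<close> are meaningful only at positive densities.  At time \<open>0\<close> the density is prescribed and may
  vanish.\<close>

definition discrete_mfg_solution ::
  "hamiltonian \<Rightarrow> real \<Rightarrow> nat \<Rightarrow> real \<Rightarrow> nat \<Rightarrow> real \<Rightarrow>
   (real \<Rightarrow> real \<times> real \<Rightarrow> real \<Rightarrow> real) \<Rightarrow> (real \<times> real \<Rightarrow> real \<Rightarrow> real) \<Rightarrow>
   (real \<times> real \<Rightarrow> real) \<Rightarrow> (nat \<Rightarrow> grid_fun) \<Rightarrow> (nat \<Rightarrow> grid_fun) \<Rightarrow> bool" where
  "discrete_mfg_solution H h Nh dt NT \<nu> f g \<rho>0 \<phi> \<rho> \<longleftrightarrow>
     (\<forall>k\<le>NT. grid_periodic Nh (\<phi> k) \<and> grid_periodic Nh (\<rho> k)) \<and>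
     (\<forall>k<NT. \<forall>i\<in>{0..<int Nh}. \<forall>j\<in>{0..<int Nh}. 0 < \<rho> (Suc k) i j) \<and>
     (\<forall>k<NT. \<forall>i\<in>{0..<int Nh}. \<forall>j\<in>{0..<int Nh}.
        - Dt dt \<phi> k i j - \<nu> * discrete_laplacian h (\<phi> k) i j
          + on_Dh h (\<phi> k)
              (\<lambda>q1 q2 q3 q4. H (real k * dt) (grid_point h i j) q1 q2 q3 q4 (\<rho> (Suc k) i j)) i j
        = f (real k * dt) (grid_point h i j) (\<rho> (Suc k) i j)) \<and>
     (\<forall>k<NT. \<forall>i\<in>{0..<int Nh}. \<forall>j\<in>{0..<int Nh}.
        Dt dt \<rho> k i j - \<nu> * discrete_laplacian h (\<rho> (Suc k)) i j
          - transport_op H h (real k * dt) (\<phi> k) (\<rho> (Suc k)) (\<rho> (Suc k)) i j = 0) \<and>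
     (\<forall>i\<in>{0..<int Nh}. \<forall>j\<in>{0..<int Nh}.
        \<rho> 0 i j = cell_average h \<rho>0 i j \<and>
        \<phi> NT i j = g (grid_point h i j) (\<rho> NT i j))"

end

theory Submission
  imports Defs
begin

text \<open>For a Hamiltonian that is continuous up to zero density and couplings that are continuous on
  \<open>[0, \<infinity>)\<close>, all unknowns \<open>\<phi>\<^sup>k\<close>, \<open>\<rho>\<^sup>k\<^sup>+\<^sup>1\<close> are put into one box, and Kuhn's labelling lemma yields a point at
  which each residual vanishes unless the coordinate lies on a face and the residual points outwards.
  For \<open>\<phi>\<close> the faces are excluded by the discrete maximum principle. For \<open>\<rho>\<close>, a residual at a zero of \<open>\<rho>\<close> is
  nonpositive, so all residuals are; as they sum to the increment of the mass, the mass does not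
  grow, the upper faces are not reached, and all residuals vanish. The diffusion gives a Harnack
  inequality, hence a positive lower bound on the density that depends only on a bound of \<open>\<phi>\<close>.

  Since \<open>f\<close> and \<open>g\<close> may tend to \<open>-\<infinity>\<close> at zero density, they are first replaced by \<open>f (max r \<delta>)\<close> and
  \<open>g (max r \<delta>)\<close>. Testing the two equations with the difference of \<open>\<rho>\<close> and the discrete heat flow \<open>\<sigma>\<close> of the
  same initial density gives \<open>\<Sum> f(\<rho>) (\<rho> - \<sigma>) + \<Sum> g(\<rho>) (\<rho> - \<sigma>) \<le> 0\<close>. By monotonicity every summand is
  bounded below, hence also above, and since \<open>\<sigma>\<close> is bounded away from zero this bounds \<open>f\<close>, \<open>g\<close>, then \<open>\<phi>\<close>,
  then \<open>\<rho>\<close> from below, uniformly in \<open>\<delta>\<close>. For small \<open>\<delta>\<close> the truncation is inactive.\<close>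

section \<open>Variational inequalities on boxes\<close>

text \<open>The topology of the function type is the product topology, so convergence is convergence
  in every coordinate.\<close>

lemma tendsto_fun_componentwise:
  fixes f :: "'b \<Rightarrow> 'a \<Rightarrow> 'c::topological_space"
  shows "(f \<longlongrightarrow> l) F \<longleftrightarrow> (\<forall>i. ((\<lambda>x. f x i) \<longlongrightarrow> l i) F)"
  using limitin_componentwise[of "\<lambda>_::'a. euclidean :: 'c topology" UNIV f l F]
  by (simp add: euclidean_product_topology limitin_canonical_iff)

text \<open>Tychonoff's theorem: the box is a product of compact intervals over the whole index
  type, which may be infinite.\<close>

lemma compact_box_fun:
  fixes lo hi :: "'a \<Rightarrow> real"
  shows "compact {x. \<forall>i. lo i \<le> x i \<and> x i \<le> hi i}"
proof -
  have eq: "{x. \<forall>i. lo i \<le> x i \<and> x i \<le> hi i} = (\<Pi>\<^sub>E i\<in>UNIV. {lo i..hi i})"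
    by (auto simp: PiE_def Pi_def extensional_def)
  show ?thesis
    unfolding eq using compactin_PiE[of "\<lambda>_::'a. euclidean :: real topology" UNIV "\<lambda>i. {lo i..hi i}"]
    by (simp add: euclidean_product_topology)
qed

text \<open>This is the coordinatewise form of the variational inequality
  \<open>sum_i g x i * (y i - x i) >= 0\<close> for all \<open>y\<close> in the box. Kuhn's lemma,
  applied to finer and finer subdivisions, gives small cubes that show both labels in every
  direction; along a subsequence they shrink to a point, and continuity carries the signs over.
  Countability of the index type turns compactness into sequential compactness.\<close>

lemma box_variational_inequality:
  fixes lo hi :: "'a::countable \<Rightarrow> real" and g :: "('a \<Rightarrow> real) \<Rightarrow> 'a \<Rightarrow> real"
  assumes fin: "finite I" and lohi: "\<And>i. i \<in> I \<Longrightarrow> lo i < hi i"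
    and cont: "\<And>i. i \<in> I \<Longrightarrow>
      continuous_on {x. \<forall>i\<in>I. lo i \<le> x i \<and> x i \<le> hi i} (\<lambda>x. g x i)"
  shows "\<exists>x. \<forall>i\<in>I. lo i \<le> x i \<and> x i \<le> hi i \<and>
    (x i = lo i \<or> g x i \<le> 0) \<and> (x i = hi i \<or> 0 \<le> g x i)"
proof -
  define B where "B = {x. \<forall>i\<in>I. lo i \<le> x i \<and> x i \<le> hi i}"
  define n where "n = card I"
  obtain e where e: "bij_betw e {..<n} I"
    using fin unfolding n_def by (metis bij_betw_from_nat_into_finite)
  define e' where "e' = the_inv_into {..<n} e"
  have e'lt: "e' i < n" if "i \<in> I" for i
    using e that unfolding e'_def bij_betw_def
    by (metis lessThan_iff order_refl the_inv_into_into)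
  have ee': "e (e' i) = i" if "i \<in> I" for i
    using e that unfolding e'_def by (simp add: f_the_inv_into_f_bij_betw)
  \<comment> \<open>The integer points between 0 and \<open>p\<close> in each direction are scaled
    to the box. Coordinates outside \<open>I\<close> are set to 0, which keeps all points in one
    compact set.\<close>
  define pt where "pt p q = (\<lambda>i. if i \<in> I then lo i + (hi i - lo i) * (real (q (e' i)) / real p) else 0)"
    for p :: nat and q :: "nat \<Rightarrow> nat"
  \<comment> \<open>Kuhn's lemma requires label 0 on the lower faces and label 1 on the upper ones;
    elsewhere the label records the sign of \<open>g\<close>. Thus label 0 means lower face or
    \<open>g <= 0\<close>, and label 1 means upper face or \<open>0 < g\<close>.\<close>
  define label where
    "label p q j = (if q j = p \<or> q j \<noteq> 0 \<and> 0 < g (pt p q) (e j) then 1 else 0::nat)" for p q j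
  have "\<exists>q r s. (\<forall>j<n. q j < p \<and> (\<forall>l<n. q l \<le> r j l \<and> r j l \<le> q l + 1) \<and>
      (\<forall>l<n. q l \<le> s j l \<and> s j l \<le> q l + 1) \<and> label p (r j) j = 0 \<and> label p (s j) j = 1)"
    if p: "0 < p" for p
  proof -
    obtain q where q: "\<forall>i<n. q i < p"
      and rs: "\<forall>i<n. \<exists>r s. (\<forall>j<n. q j \<le> r j \<and> r j \<le> q j + 1) \<and>
            (\<forall>j<n. q j \<le> s j \<and> s j \<le> q j + 1) \<and> label p r i \<noteq> label p s i"
      by (rule kuhn_lemma[of p n "label p"]) (use p in \<open>auto simp: label_def\<close>)
    \<comment> \<open>Kuhn's lemma only says that the two labels differ. Interchanging the vertices
      if necessary lets \<open>r\<close> carry label 0 and \<open>s\<close> label 1.\<close>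
    have "\<exists>r s. (\<forall>j<n. q j \<le> r j \<and> r j \<le> q j + 1) \<and>
            (\<forall>j<n. q j \<le> s j \<and> s j \<le> q j + 1) \<and> label p r i = 0 \<and> label p s i = 1" if "i < n" for i
    proof -
      from rs[rule_format, OF that] obtain r s where r: "\<forall>j<n. q j \<le> r j \<and> r j \<le> q j + 1"
        and s: "\<forall>j<n. q j \<le> s j \<and> s j \<le> q j + 1" and ne: "label p r i \<noteq> label p s i"
        by (elim exE conjE)
      have "label p u i = 0 \<or> label p u i = 1" for u by (simp add: label_def)
      then consider "label p r i = 0 \<and> label p s i = 1" | "label p s i = 0 \<and> label p r i = 1"
        using ne by metis
      then show ?thesis
      proof cases
        case 1
        with r s show ?thesis by (intro exI[of _ r] exI[of _ s] conjI) simp_all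
      next
        case 2
        with r s show ?thesis by (intro exI[of _ s] exI[of _ r] conjI) simp_all
      qed
    qed
    then have "\<forall>i\<in>{..<n}. \<exists>r s. (\<forall>j<n. q j \<le> r j \<and> r j \<le> q j + 1) \<and>
            (\<forall>j<n. q j \<le> s j \<and> s j \<le> q j + 1) \<and> label p r i = 0 \<and> label p s i = 1"
      by simp
    then obtain r s where "\<forall>i\<in>{..<n}. (\<forall>j<n. q j \<le> r i j \<and> r i j \<le> q j + 1) \<and>
            (\<forall>j<n. q j \<le> s i j \<and> s i j \<le> q j + 1) \<and> label p (r i) i = 0 \<and> label p (s i) i = 1"
      unfolding bchoice_iff by (elim exE)
    with q show ?thesis by (intro exI[of _ q] exI[of _ r] exI[of _ s]) simp
  qed
  then have "\<forall>m. \<exists>q r s. (\<forall>j<n. q j < Suc m \<and> (\<forall>l<n. q l \<le> r j l \<and> r j l \<le> q l + 1) \<and>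
      (\<forall>l<n. q l \<le> s j l \<and> s j l \<le> q l + 1) \<and> label (Suc m) (r j) j = 0 \<and> label (Suc m) (s j) j = 1)"
    by simp
  then have "\<exists>q r s. \<forall>m. (\<forall>j<n. q m j < Suc m \<and> (\<forall>l<n. q m l \<le> r m j l \<and> r m j l \<le> q m l + 1) \<and>
      (\<forall>l<n. q m l \<le> s m j l \<and> s m j l \<le> q m l + 1) \<and>
      label (Suc m) (r m j) j = 0 \<and> label (Suc m) (s m j) j = 1)"
    unfolding choice_iff .
  then obtain q r s where qrs: "\<forall>m. \<forall>j<n. q m j < Suc m \<and>
      (\<forall>l<n. q m l \<le> r m j l \<and> r m j l \<le> q m l + 1) \<and>
      (\<forall>l<n. q m l \<le> s m j l \<and> s m j l \<le> q m l + 1) \<and>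
      label (Suc m) (r m j) j = 0 \<and> label (Suc m) (s m j) j = 1"
    by (elim exE)
  have q: "q m j < Suc m"
    and lr: "label (Suc m) (r m j) j = 0" and ls: "label (Suc m) (s m j) j = 1" if "j < n" for m j
    using qrs that by simp_all
  have r: "q m l \<le> r m j l \<and> r m j l \<le> q m l + 1"
    and s: "q m l \<le> s m j l \<and> s m j l \<le> q m l + 1" if "j < n" "l < n" for m j l
    using qrs that by simp_all
  have inB: "lo i \<le> pt (Suc m) u i \<and> pt (Suc m) u i \<le> hi i"
    if "i \<in> I" "\<And>l. l < n \<Longrightarrow> u l \<le> Suc m" for u m i
  proof -
    have "real (u (e' i)) / real (Suc m) \<le> 1" using of_nat_mono[OF that(2)[OF e'lt[OF that(1)]], where ?'a = real] by (simp add: divide_le_eq)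
    moreover have "0 \<le> real (u (e' i)) / real (Suc m)" by simp
    ultimately have "(hi i - lo i) * (real (u (e' i)) / real (Suc m)) \<le> (hi i - lo i) * 1"
       "0 \<le> (hi i - lo i) * (real (u (e' i)) / real (Suc m))"
      using lohi[OF that(1)] by (intro mult_left_mono mult_nonneg_nonneg; simp)+
    then show ?thesis unfolding pt_def using that(1) by simp
  qed
  \<comment> \<open>The index type can be larger than \<open>I\<close>; pinning the other
    coordinates to 0 makes the box compact.\<close>
  define C where "C = {x. \<forall>i. (if i \<in> I then lo i else 0) \<le> x i \<and> x i \<le> (if i \<in> I then hi i else 0)}"
  have "seq_compact C"
    unfolding C_def by (intro compact_imp_seq_compact compact_box_fun)
  have ptC: "pt (Suc m) (q m) \<in> C" for m
  proof -
    have le: "q m l \<le> Suc m" if "l < n" for l using q[OF that, of m] by simp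
    have "lo i \<le> pt (Suc m) (q m) i \<and> pt (Suc m) (q m) i \<le> hi i" if "i \<in> I" for i
      by (rule inB[OF that]) (rule le)
    then show ?thesis unfolding C_def by (simp add: pt_def)
  qed
  obtain x \<sigma> where x: "x \<in> C" and \<sigma>: "strict_mono \<sigma>"
    and lim: "((\<lambda>m. pt (Suc m) (q m)) \<circ> \<sigma>) \<longlonglongrightarrow> x"
    using \<open>seq_compact C\<close>[unfolded seq_compact_def, rule_format, of "\<lambda>m. pt (Suc m) (q m)", OF ptC]
    by (elim bexE exE conjE)
  \<comment> \<open>All vertices of a small cube lie within one mesh width of its base vertex, so
    they share its limit.\<close>
  have close: "(\<lambda>m. pt (Suc (\<sigma> m)) (u (\<sigma> m))) \<longlonglongrightarrow> x"
    if u: "\<And>m l. l < n \<Longrightarrow> q m l \<le> u m l \<and> u m l \<le> q m l + 1" for u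
    unfolding tendsto_fun_componentwise
  proof
    fix i
    show "(\<lambda>m. pt (Suc (\<sigma> m)) (u (\<sigma> m)) i) \<longlonglongrightarrow> x i"
    proof (cases "i \<in> I")
      case False
      have "(if i \<in> I then lo i else 0) \<le> x i \<and> x i \<le> (if i \<in> I then hi i else 0)"
        using x unfolding C_def by simp
      with False have "x i = 0" by simp
      then show ?thesis using False by (simp add: pt_def)
    next
      case True
      have L1: "(\<lambda>m. pt (Suc (\<sigma> m)) (q (\<sigma> m)) i) \<longlonglongrightarrow> x i"
        using lim unfolding tendsto_fun_componentwise by (simp add: o_def)
      have L2: "(\<lambda>m. (hi i - lo i) * (1 / real (Suc (\<sigma> m)))) \<longlonglongrightarrow> (hi i - lo i) * 0"
        using LIMSEQ_subseq_LIMSEQ[OF LIMSEQ_inverse_real_of_nat \<sigma>]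
        by (intro tendsto_mult tendsto_const) (simp add: o_def inverse_eq_divide)
      have L3: "(\<lambda>m. pt (Suc (\<sigma> m)) (q (\<sigma> m)) i + (hi i - lo i) * (1 / real (Suc (\<sigma> m)))) \<longlonglongrightarrow> x i"
        using tendsto_add[OF L1 L2] by simp
      have mono: "(hi i - lo i) * (real a / real (Suc m)) \<le> (hi i - lo i) * (real b / real (Suc m))"
        if "a \<le> b" for a b m
        using that lohi[OF True] by (intro mult_left_mono divide_right_mono) auto
      show ?thesis
      proof (rule tendsto_sandwich[OF _ _ L1 L3])
        show "\<forall>\<^sub>F m in sequentially. pt (Suc (\<sigma> m)) (q (\<sigma> m)) i \<le> pt (Suc (\<sigma> m)) (u (\<sigma> m)) i"
          using True u e'lt mono by (auto simp: pt_def)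
        show "\<forall>\<^sub>F m in sequentially. pt (Suc (\<sigma> m)) (u (\<sigma> m)) i
           \<le> pt (Suc (\<sigma> m)) (q (\<sigma> m)) i + (hi i - lo i) * (1 / real (Suc (\<sigma> m)))"
        proof (intro always_eventually allI)
          fix m
          have "(hi i - lo i) * (real (u (\<sigma> m) (e' i)) / real (Suc (\<sigma> m)))
            \<le> (hi i - lo i) * (real (q (\<sigma> m) (e' i) + 1) / real (Suc (\<sigma> m)))"
            using u[OF e'lt[OF True]] by (intro mono) auto
          then show "pt (Suc (\<sigma> m)) (u (\<sigma> m)) i
           \<le> pt (Suc (\<sigma> m)) (q (\<sigma> m)) i + (hi i - lo i) * (1 / real (Suc (\<sigma> m)))"
            using True by (simp add: pt_def add_divide_distrib ring_distribs)
        qed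
      qed
    qed
  qed
  have xB: "x \<in> B"
  proof -
    have "lo i \<le> x i \<and> x i \<le> hi i" if "i \<in> I" for i
    proof -
      have "(if i \<in> I then lo i else 0) \<le> x i \<and> x i \<le> (if i \<in> I then hi i else 0)"
        using x unfolding C_def by simp
      with that show ?thesis by simp
    qed
    then show ?thesis unfolding B_def by simp
  qed
  have glim: "(\<lambda>m. g (pt (Suc (\<sigma> m)) (u (\<sigma> m))) i) \<longlonglongrightarrow> g x i"
    if u: "\<And>m l. l < n \<Longrightarrow> q m l \<le> u m l \<and> u m l \<le> q m l + 1" and i: "i \<in> I" for u i
  proof (rule continuous_on_tendsto_compose[OF cont[OF i] close])
    have "u m l \<le> Suc m" if "l < n" for m l using u[OF that, of m] q[OF that, of m] by auto
    then show "\<forall>\<^sub>F m in sequentially. pt (Suc (\<sigma> m)) (u (\<sigma> m)) \<in> {x. \<forall>i\<in>I. lo i \<le> x i \<and> x i \<le> hi i}"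
      using inB by auto
  qed (use xB u in \<open>auto simp: B_def\<close>)
  show ?thesis
  proof (intro exI[of _ x] ballI conjI)
    fix i assume i: "i \<in> I"
    show "lo i \<le> x i" "x i \<le> hi i" using xB i by (auto simp: B_def)
    let ?j = "e' i"
    note j = e'lt[OF i] ee'[OF i]
    \<comment> \<open>If \<open>g\<close> is positive at the limit, it is eventually positive at the
      vertices \<open>r\<close>; having label 0, these must lie on the lower face. The other half is
      the same argument with \<open>s\<close> and the upper face.\<close>
    show "x i = lo i \<or> g x i \<le> 0"
    proof (rule disjCI)
      assume "\<not> g x i \<le> 0"
      then have "\<forall>\<^sub>F m in sequentially. 0 < g (pt (Suc (\<sigma> m)) (r (\<sigma> m) ?j)) i"
        using order_tendstoD(1)[OF glim[of "\<lambda>m. r m ?j", OF _ i]] r j(1) by simp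
      then have "\<forall>\<^sub>F m in sequentially. pt (Suc (\<sigma> m)) (r (\<sigma> m) ?j) i = lo i"
      proof eventually_elim
        case (elim m)
        with lr[OF j(1), of "\<sigma> m"] i j(2) show ?case
          by (auto simp: label_def pt_def split: if_splits)
      qed
      then have "(\<lambda>m. pt (Suc (\<sigma> m)) (r (\<sigma> m) ?j) i) \<longlonglongrightarrow> lo i"
        by (rule tendsto_eventually)
      moreover have "(\<lambda>m. pt (Suc (\<sigma> m)) (r (\<sigma> m) ?j) i) \<longlonglongrightarrow> x i"
        using close[of "\<lambda>m. r m ?j"] r j(1) unfolding tendsto_fun_componentwise by simp
      ultimately show "x i = lo i" using LIMSEQ_unique by blast
    qed
    show "x i = hi i \<or> 0 \<le> g x i"
    proof (rule disjCI)
      assume "\<not> 0 \<le> g x i"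
      then have "\<forall>\<^sub>F m in sequentially. g (pt (Suc (\<sigma> m)) (s (\<sigma> m) ?j)) i < 0"
        using order_tendstoD(2)[OF glim[of "\<lambda>m. s m ?j", OF _ i]] s j(1) by simp
      then have "\<forall>\<^sub>F m in sequentially. pt (Suc (\<sigma> m)) (s (\<sigma> m) ?j) i = hi i"
      proof eventually_elim
        case (elim m)
        with ls[OF j(1), of "\<sigma> m"] i j(2) show ?case
          by (auto simp: label_def pt_def split: if_splits)
      qed
      then have "(\<lambda>m. pt (Suc (\<sigma> m)) (s (\<sigma> m) ?j) i) \<longlonglongrightarrow> hi i"
        by (rule tendsto_eventually)
      moreover have "(\<lambda>m. pt (Suc (\<sigma> m)) (s (\<sigma> m) ?j) i) \<longlonglongrightarrow> x i"
        using close[of "\<lambda>m. s m ?j"] s j(1) unfolding tendsto_fun_componentwise by simp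
      ultimately show "x i = hi i" using LIMSEQ_unique by blast
    qed
  qed
qed

section \<open>Cell averages\<close>

text \<open>The affine change of variables with all scale factors equal to 1.\<close>

lemma lebesgue_translation:
  fixes a :: "'a::euclidean_space"
  shows "lebesgue = distr lebesgue lebesgue (\<lambda>x. a + x)"
    and lebesgue_translation_measurable: "(\<lambda>x. a + x) \<in> lebesgue \<rightarrow>\<^sub>M lebesgue"
proof -
  have T: "(\<lambda>x. a + (\<Sum>j\<in>Basis. (1 * (x \<bullet> j)) *\<^sub>R j)) = (\<lambda>x. a + x)"
    by (simp add: euclidean_representation)
  show "(\<lambda>x. a + x) \<in> lebesgue \<rightarrow>\<^sub>M lebesgue"
    using lebesgue_affine_measurable[of "\<lambda>_::'a. 1" a] unfolding T by simp
  show "lebesgue = distr lebesgue lebesgue (\<lambda>x. a + x)"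
    using lebesgue_affine_euclidean[of "\<lambda>_::'a. 1" a] unfolding T by (simp add: density_1)
qed

lemma integrable_lebesgue_translation:
  fixes f :: "'a::euclidean_space \<Rightarrow> real"
  assumes "integrable lebesgue f"
  shows "integrable lebesgue (\<lambda>x. f (a + x))"
proof -
  have "integrable (distr lebesgue lebesgue (\<lambda>x. a + x)) f"
    using assms lebesgue_translation[of a] by simp
  then show ?thesis
    using integrable_distr_eq[OF lebesgue_translation_measurable[of a], of f] assms by simp
qed

lemma integral_lebesgue_translation:
  fixes f :: "'a::euclidean_space \<Rightarrow> real"
  assumes "integrable lebesgue f"
  shows "integral\<^sup>L lebesgue (\<lambda>x. f (a + x)) = integral\<^sup>L lebesgue f"
  using integral_distr[OF lebesgue_translation_measurable[of a], of f] assms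
    lebesgue_translation[of a] by simp

lemma torus_fun_int_shift:
  assumes "torus_fun r"
  shows "r (x + of_int m, y + of_int n) = r (x, y)"
proof -
  have "r (x + of_int m, y) = r (x, y)" for m :: int and x y
  proof (induction m arbitrary: x rule: int_induct[where k = 0])
    case (step1 i)
    from step1(2)[of "x + 1"] show ?case using assms unfolding torus_fun_def by (simp add: add.assoc add.commute[of 1])
  next
    case (step2 i)
    from step2(2)[of "x - 1"] show ?case using assms unfolding torus_fun_def
      by (metis add.commute add_diff_cancel_left' diff_add_eq of_int_1 of_int_diff uminus_add_conv_diff)
  qed simp
  moreover have "r (x, y + of_int n) = r (x, y)" for n :: int and x y
  proof (induction n arbitrary: y rule: int_induct[where k = 0])
    case (step1 i)
    from step1(2)[of "y + 1"] show ?case using assms unfolding torus_fun_def by (simp add: add.assoc add.commute[of 1])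
  next
    case (step2 i)
    from step2(2)[of "y - 1"] show ?case using assms unfolding torus_fun_def
      by (metis add.commute add_diff_cancel_left' diff_add_eq of_int_1 of_int_diff uminus_add_conv_diff)
  qed simp
  ultimately show ?thesis by simp
qed

definition cell :: "real \<Rightarrow> int \<Rightarrow> int \<Rightarrow> (real \<times> real) set" where
  "cell h i j = {x. max \<bar>fst x - fst (grid_point h i j)\<bar> \<bar>snd x - snd (grid_point h i j)\<bar> \<le> h / 2}"

lemma cell_cbox: "cell h i j = cbox (of_int i * h - h/2, of_int j * h - h/2) (of_int i * h + h/2, of_int j * h + h/2)"
  unfolding cell_def grid_point_def cbox_Pair_eq unfolding cbox_interval
  by (rule set_eqI, simp only: mem_Collect_eq max.bounded_iff abs_le_iff mem_Times_iff
      atLeastAtMost_iff fst_conv snd_conv) (safe; linarith)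

text \<open>A bounded set is covered by finitely many integer translates of the unit square, and
  periodicity makes \<open>r\<close> integrable on each of them. This is needed because the cells at
  the border stick out of the unit square.\<close>

lemma torus_prob_density_integrable:
  assumes r: "torus_prob_density r" and S: "S \<in> sets lebesgue" "bounded S"
  shows "set_integrable lebesgue S r"
proof -
  have per: "torus_fun r" and int: "set_integrable lebesgue ({0..1} \<times> {0..1}) r"
    using r by (auto simp: torus_prob_density_def)
  define Q where "Q m = {real_of_int m..of_int m + 1}" for m :: int
  have Q: "set_integrable lebesgue (Q (fst p) \<times> Q (snd p)) r" for p
  proof -
    obtain m n where p: "p = (m, n)" by fastforce
    have "(\<lambda>x. indicator ({0..1} \<times> {0..1}) ((- of_int m, - of_int n) + x) *\<^sub>R r ((- of_int m, - of_int n) + x))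
      = (\<lambda>x. indicator (Q m \<times> Q n) x *\<^sub>R r x)"
      using torus_fun_int_shift[OF per, of _ "- m" _ "- n"]
      by (auto simp: fun_eq_iff Q_def indicator_def)
    then show ?thesis
      using integrable_lebesgue_translation[OF int[unfolded set_integrable_def],
          of "(- of_int m, - of_int n)"] by (simp add: set_integrable_def p)
  qed
  obtain K where K: "\<And>x. x \<in> S \<Longrightarrow> norm x \<le> K" using S(2) by (auto simp: bounded_iff)
  define D where "D = {\<lfloor>-K\<rfloor>..\<lfloor>K\<rfloor>} \<times> {\<lfloor>-K\<rfloor>..\<lfloor>K\<rfloor>}"
  have "set_integrable lebesgue (\<Union>p\<in>D. Q (fst p) \<times> Q (snd p)) r"
  proof (rule set_integrable_UN)
    show "finite D" by (simp add: D_def)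
    show "Q (fst p) \<times> Q (snd p) \<in> sets lebesgue" for p
      unfolding Q_def cbox_interval[symmetric] cbox_Pair_eq[symmetric] by simp
  qed (use Q in auto)
  moreover have "S \<subseteq> (\<Union>p\<in>D. Q (fst p) \<times> Q (snd p))"
  proof
    fix x assume "x \<in> S"
    have "\<bar>fst x\<bar> \<le> K" "\<bar>snd x\<bar> \<le> K"
      using K[OF \<open>x \<in> S\<close>] norm_fst_le[of "fst x" "snd x"] norm_snd_le[of "snd x" "fst x"] by auto
    then have "(\<lfloor>fst x\<rfloor>, \<lfloor>snd x\<rfloor>) \<in> D"
      unfolding D_def by (auto intro!: floor_mono)
    moreover have "x \<in> Q \<lfloor>fst x\<rfloor> \<times> Q \<lfloor>snd x\<rfloor>"
      by (auto simp: Q_def mem_Times_iff intro!: less_imp_le)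
    ultimately show "x \<in> (\<Union>p\<in>D. Q (fst p) \<times> Q (snd p))" by force
  qed
  ultimately show ?thesis using S(1) set_integrable_subset by blast
qed

lemma cell_average_eq:
  "cell_average h r i j = 1 / h\<^sup>2 * (LINT x : cell h i j | lebesgue. r x)"
  by (simp add: cell_average_def cell_def)

lemma cell_average_nonneg:
  assumes "torus_prob_density r" and "h > 0"
  shows "0 \<le> cell_average h r i j"
proof -
  have "\<And>x. 0 \<le> r x" using assms(1) unfolding torus_prob_density_def by blast
  then show ?thesis
    unfolding cell_average_eq set_lebesgue_integral_def by (intro mult_nonneg_nonneg integral_nonneg) auto
qed

text \<open>Since \<open>N * h = 1\<close>, moving a cell by a multiple of \<open>N\<close> indices
  is an integer translation, and it leaves both the measure and \<open>r\<close> invariant.\<close>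

lemma cell_average_shift:
  assumes r: "torus_prob_density r" and h: "h > 0" "real N * h = 1"
  shows "cell_average h r (i + int N * m) (j + int N * n) = cell_average h r i j"
proof -
  have per: "torus_fun r" using r by (auto simp: torus_prob_density_def)
  have int: "integrable lebesgue (\<lambda>x. indicator (cell h i j) x *\<^sub>R r x)" for i j
    using torus_prob_density_integrable[OF r, of "cell h i j"]
    unfolding cell_cbox by (simp add: set_integrable_def)
  have sh: "real_of_int (i + int N * m) * h = of_int i * h + of_int m" for i m
  proof -
    have "real_of_int (i + int N * m) * h = of_int i * h + (real N * h) * of_int m"
      by (simp add: algebra_simps)
    then show ?thesis using h(2) by simp
  qed
  have "(\<lambda>x. indicator (cell h (i + int N * m) (j + int N * n)) ((of_int m, of_int n) + x) *\<^sub>R r ((of_int m, of_int n) + x))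
      = (\<lambda>x. indicator (cell h i j) x *\<^sub>R r x)"
    unfolding cell_cbox sh using torus_fun_int_shift[OF per, of _ m _ n]
    by (auto simp: fun_eq_iff indicator_def cbox_Pair_eq add.commute add.left_commute)
  then show ?thesis
    using integral_lebesgue_translation[OF int[of "i + int N * m" "j + int N * n"], of "(of_int m, of_int n)"]
    by (simp add: cell_average_eq set_lebesgue_integral_def)
qed

text \<open>The closed cells cover the unit square, so their integrals sum to at least 1 and one of
  them is positive. Overlaps do no harm: of the total mass only its positivity is needed
  later.\<close>

lemma cell_average_pos:
  assumes r: "torus_prob_density r" and h: "h > 0" "real N * h = 1"
  obtains i j where "i \<in> {0..<int N}" "j \<in> {0..<int N}" "0 < cell_average h r i j"
proof -
  have rnn: "\<And>x. 0 \<le> r x" and one: "(LINT x : {0..1} \<times> {0..1} | lebesgue. r x) = 1"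
    and int1: "set_integrable lebesgue ({0..1} \<times> {0..1}) r"
    using r by (auto simp: torus_prob_density_def)
  have N: "0 < N" using h by (cases N) auto
  have int: "integrable lebesgue (\<lambda>x. indicator (cell h i j) x *\<^sub>R r x)" for i j
    using torus_prob_density_integrable[OF r, of "cell h i j"]
    unfolding cell_cbox by (simp add: set_integrable_def)
  \<comment> \<open>Both indices 0 and \<open>N\<close> are included: each of these cells covers
    only a half cell at its end of the unit interval. The duplicate is folded back modulo
    \<open>N\<close> at the end.\<close>
  define D where "D = {0..int N} \<times> {0..int N}"
  have cover: "\<exists>i\<in>{0..int N}. of_int i * h - h / 2 \<le> a \<and> a \<le> of_int i * h + h / 2"
    if a: "0 \<le> a" "a \<le> 1" for a
  proof (rule bexI)
    \<comment> \<open>The index of a grid point nearest to \<open>a\<close>.\<close>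
    let ?i = "\<lfloor>a / h + 1 / 2\<rfloor>"
    have l: "of_int ?i \<le> a / h + 1 / 2" "a / h + 1 / 2 < of_int ?i + 1" by linarith+
    have "a / h \<le> real N" using a h by (simp add: field_simps)
    moreover have "0 \<le> a / h" using a h by simp
    ultimately show "?i \<in> {0..int N}" by (auto simp: floor_le_iff)
    have "of_int ?i * h \<le> (a / h + 1 / 2) * h" "(a / h + 1 / 2) * h \<le> (of_int ?i + 1) * h"
      using l h(1) by (intro mult_right_mono; simp)+
    moreover have "(a / h + 1 / 2) * h = a + h / 2" using h(1) by (simp add: field_simps)
    ultimately show "of_int ?i * h - h / 2 \<le> a \<and> a \<le> of_int ?i * h + h / 2"
      unfolding distrib_right by linarith
  qed
  have "1 = integral\<^sup>L lebesgue (\<lambda>x. indicator ({0..1} \<times> {0..1}) x *\<^sub>R r x)"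
    using one by (simp add: set_lebesgue_integral_def)
  also have "\<dots> \<le> integral\<^sup>L lebesgue (\<lambda>x. \<Sum>p\<in>D. indicator (cell h (fst p) (snd p)) x *\<^sub>R r x)"
  proof (rule integral_mono)
    fix x :: "real \<times> real"
    show "indicator ({0..1} \<times> {0..1}) x *\<^sub>R r x \<le> (\<Sum>p\<in>D. indicator (cell h (fst p) (snd p)) x *\<^sub>R r x)"
    proof (cases "x \<in> {0..1} \<times> {0..1}")
      case True
      then obtain i j where ij: "i \<in> {0..int N}" "j \<in> {0..int N}" "x \<in> cell h i j"
        using cover[of "fst x"] cover[of "snd x"] unfolding cell_cbox
        by (cases x) (auto simp: cbox_Pair_eq)
      have "indicator (cell h (fst (i,j)) (snd (i,j))) x *\<^sub>R r x
          \<le> (\<Sum>p\<in>D. indicator (cell h (fst p) (snd p)) x *\<^sub>R r x)"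
        by (rule member_le_sum) (use ij rnn in \<open>auto simp: D_def\<close>)
      then show ?thesis using True ij by simp
    qed (simp add: rnn sum_nonneg)
  qed (use int int1 in \<open>auto simp: set_integrable_def\<close>)
  also have "\<dots> = (\<Sum>p\<in>D. h\<^sup>2 * cell_average h r (fst p) (snd p))"
    using int h(1) by (simp add: cell_average_eq set_lebesgue_integral_def)
  finally have "\<exists>p\<in>D. 0 < h\<^sup>2 * cell_average h r (fst p) (snd p)"
    by (metis (no_types, lifting) less_numeral_extra(1) not_less order_less_le_trans sum_nonpos)
  then obtain i j where "0 < cell_average h r i j"
    using h(1) by (auto simp: zero_less_mult_iff)
  then have "0 < cell_average h r (i mod int N) (j mod int N)"
    using cell_average_shift[OF r h, of "i mod int N" "i div int N" "j mod int N" "j div int N"] by simp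
  then show thesis using N by (intro that[of "i mod int N" "j mod int N"]) auto
qed

section \<open>Summation on the periodic grid\<close>

lemma grid_periodic_shift:
  assumes "grid_periodic N u"
  shows "grid_periodic N (\<lambda>i j. u (i + a) (j + b))"
proof -
  have "u (i + int N + a) (j + b) = u (i + a + int N) (j + b)"
    "u (i + a) (j + int N + b) = u (i + a) (j + b + int N)" for i j
    by (simp_all add: add_ac)
  then show ?thesis using assms by (simp add: grid_periodic_def)
qed

lemma grid_periodic_shifts:
  assumes "grid_periodic N u"
  shows "grid_periodic N (\<lambda>i j. u (i + a) j)" "grid_periodic N (\<lambda>i j. u i (j + b))"
    "grid_periodic N (\<lambda>i j. u (i - a) j)" "grid_periodic N (\<lambda>i j. u i (j - b))"
  using grid_periodic_shift[OF assms, of a 0] grid_periodic_shift[OF assms, of 0 b]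
    grid_periodic_shift[OF assms, of "-a" 0] grid_periodic_shift[OF assms, of 0 "-b"]
  by simp_all

lemma grid_periodic_arith:
  assumes "grid_periodic N u" "grid_periodic N v"
  shows "grid_periodic N (\<lambda>i j. u i j + v i j)" "grid_periodic N (\<lambda>i j. u i j - v i j)"
    "grid_periodic N (\<lambda>i j. u i j * v i j)"
  using assms by (simp_all add: grid_periodic_def)

lemma periodic_int_shift:
  fixes v :: "int \<Rightarrow> 'a"
  assumes v: "\<And>i. v (i + p) = v i"
  shows "v (i + p * m) = v i"
proof (induction m arbitrary: i rule: int_induct[where k = 0])
  case (step1 m)
  have "v (i + p * (m + 1)) = v (i + p + p * m)" by (simp add: algebra_simps)
  then show ?case using step1(2)[of "i + p"] v by simp
next
  case (step2 m)
  have "v (i + p * (m - 1)) = v (i - p + p * m)" by (simp add: algebra_simps)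
  then show ?case using step2(2)[of "i - p"] v[of "i - p"] by simp
qed simp

lemma periodic_int_mod:
  fixes v :: "int \<Rightarrow> 'a"
  assumes v: "\<And>i. v (i + p) = v i"
  shows "v (i mod p) = v i"
  using periodic_int_shift[of v p "i mod p" "i div p"] v by simp

lemma grid_periodic_mod:
  assumes "grid_periodic N u"
  shows "u (i mod int N) (j mod int N) = u i j"
  using periodic_int_mod[of "\<lambda>i. u i (j mod int N)" "int N" i]
    periodic_int_mod[of "\<lambda>j. u i j" "int N" j] assms by (simp add: grid_periodic_def)

definition gsum :: "nat \<Rightarrow> grid_fun \<Rightarrow> real" where
  "gsum N u = (\<Sum>i\<in>{0..<int N}. \<Sum>j\<in>{0..<int N}. u i j)"

lemma sum_periodic_shift:
  fixes v :: "int \<Rightarrow> real"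
  assumes v: "\<And>i. v (i + int N) = v i"
  shows "(\<Sum>i\<in>{0..<int N}. v (i + a)) = (\<Sum>i\<in>{0..<int N}. v i)"
proof (cases "N = 0")
  case False
  have "v ((i + a) mod int N) = v (i + a)" for i
    by (rule periodic_int_mod[of v "int N", OF v])
  moreover have "((i + a) mod int N - a) mod int N = i" "((i - a) mod int N + a) mod int N = i"
    if "i \<in> {0..<int N}" for i
    using that by (simp_all add: mod_diff_left_eq mod_add_left_eq)
  moreover have "k mod int N \<in> {0..<int N}" for k using False by simp
  ultimately show ?thesis
    by (intro sum.reindex_bij_witness[where i = "\<lambda>i. (i - a) mod int N" and j = "\<lambda>i. (i + a) mod int N"])
      simp_all
qed simp

lemma gsum_shift:
  assumes "grid_periodic N u"
  shows "gsum N (\<lambda>i j. u (i + a) (j + b)) = gsum N u"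
proof -
  have "gsum N (\<lambda>i j. u (i + a) (j + b)) = (\<Sum>i\<in>{0..<int N}. \<Sum>j\<in>{0..<int N}. u (i + a) j)"
    unfolding gsum_def using assms
    by (intro sum.cong refl sum_periodic_shift) (simp add: grid_periodic_def)
  also have "\<dots> = gsum N u"
    unfolding gsum_def using assms
    by (intro sum_periodic_shift[of "\<lambda>i. \<Sum>j\<in>{0..<int N}. u i j"]) (simp add: grid_periodic_def)
  finally show ?thesis .
qed

lemma gsum_add: "gsum N (\<lambda>i j. u i j + v i j) = gsum N u + gsum N v"
  by (simp add: gsum_def sum.distrib)

lemma gsum_diff: "gsum N (\<lambda>i j. u i j - v i j) = gsum N u - gsum N v"
  by (simp add: gsum_def sum_subtractf)

lemma gsum_scale: "gsum N (\<lambda>i j. c * u i j) = c * gsum N u"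
  by (simp add: gsum_def sum_distrib_left)

lemma gsum_divide: "gsum N (\<lambda>i j. u i j / c) = gsum N u / c"
  by (simp add: gsum_def sum_divide_distrib)

lemma gsum_cong:
  assumes "\<And>i j. i \<in> {0..<int N} \<Longrightarrow> j \<in> {0..<int N} \<Longrightarrow> u i j = v i j"
  shows "gsum N u = gsum N v"
  unfolding gsum_def using assms by (intro sum.cong) auto

lemma gsum_mono:
  assumes "\<And>i j. i \<in> {0..<int N} \<Longrightarrow> j \<in> {0..<int N} \<Longrightarrow> u i j \<le> v i j"
  shows "gsum N u \<le> gsum N v"
  unfolding gsum_def using assms by (intro sum_mono) auto

lemma gsum_nonneg:
  assumes "\<And>i j. i \<in> {0..<int N} \<Longrightarrow> j \<in> {0..<int N} \<Longrightarrow> 0 \<le> u i j"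
  shows "0 \<le> gsum N u"
  unfolding gsum_def using assms by (intro sum_nonneg) auto

lemma gsum_const: "gsum N (\<lambda>i j. c) = (real N)\<^sup>2 * c"
  by (simp add: gsum_def power2_eq_square)

lemma gsum_member_le:
  assumes "\<And>i j. i \<in> {0..<int N} \<Longrightarrow> j \<in> {0..<int N} \<Longrightarrow> 0 \<le> u i j"
    and "i \<in> {0..<int N}" "j \<in> {0..<int N}"
  shows "u i j \<le> gsum N u"
proof -
  have "u i j \<le> (\<Sum>j\<in>{0..<int N}. u i j)"
    using assms(1)[OF assms(2)] assms(3) by (intro member_le_sum) simp_all
  also have "\<dots> \<le> gsum N u"
    unfolding gsum_def
  proof (rule member_le_sum[of i _ "\<lambda>i. \<Sum>j\<in>{0..<int N}. u i j"])
    show "0 \<le> (\<Sum>j\<in>{0..<int N}. u k j)" if "k \<in> {0..<int N} - {i}" for k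
      by (rule sum_nonneg, rule assms(1)) (use that in simp_all)
  qed (use assms(2) in simp_all)
  finally show ?thesis .
qed

lemma gsum_telescope:
  assumes "grid_periodic N u"
  shows "gsum N (\<lambda>i j. u i j - u (i - a) (j - b)) = 0"
  using gsum_shift[OF assms, of "-a" "-b"] by (simp add: gsum_diff)

text \<open>Discrete Green identity: the difference of the two integrands is a divergence of the
  fluxes \<open>X\<close> and \<open>Y\<close>, and it telescopes over a period.\<close>

lemma gsum_laplacian_symmetric:
  assumes u: "grid_periodic N u" and v: "grid_periodic N v"
  shows "gsum N (\<lambda>i j. u i j * discrete_laplacian h v i j) = gsum N (\<lambda>i j. discrete_laplacian h u i j * v i j)"
proof -
  define X where "X i j = u (i + 1) j * v i j - u i j * v (i + 1) j" for i j
  define Y where "Y i j = u i (j + 1) * v i j - u i j * v i (j + 1)" for i j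
  have X: "grid_periodic N X" and Y: "grid_periodic N Y"
    unfolding X_def Y_def by (intro grid_periodic_arith grid_periodic_shifts u v)+
  have "gsum N (\<lambda>i j. discrete_laplacian h u i j * v i j) - gsum N (\<lambda>i j. u i j * discrete_laplacian h v i j)
    = gsum N (\<lambda>i j. ((X i j - X (i - 1) (j - 0)) + (Y i j - Y (i - 0) (j - 1))) / (4 * h\<^sup>2))"
    unfolding gsum_diff[symmetric] X_def Y_def discrete_laplacian_def
    unfolding divide_inverse by (intro gsum_cong) (simp only: diff_add_cancel diff_zero, algebra)
  also have "\<dots> = 0"
    unfolding gsum_divide gsum_add gsum_telescope[OF X] gsum_telescope[OF Y] by simp
  finally show ?thesis by simp
qed

lemma gsum_laplacian:
  assumes "grid_periodic N v"
  shows "gsum N (discrete_laplacian h v) = 0"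
  using gsum_laplacian_symmetric[OF _ assms, of "\<lambda>i j. 1" h]
  by (simp add: grid_periodic_def discrete_laplacian_def[of h "\<lambda>i j. 1"] gsum_const)

text \<open>Summation by parts: the divergence on the left is minus the adjoint of the
  four-component gradient, because both integrands together telescope through the fluxes
  \<open>X\<close> and \<open>Y\<close>.\<close>

lemma gsum_divergence:
  assumes u: "grid_periodic N u" and p: "grid_periodic N p1" "grid_periodic N p2" "grid_periodic N p3" "grid_periodic N p4"
  shows "gsum N (\<lambda>i j. u i j * (1 / h * ((p1 i j - p1 (i - 1) j) + (p2 (i + 1) j - p2 i j)
      + (p3 i j - p3 i (j - 1)) + (p4 i (j + 1) - p4 i j))))
    = - gsum N (\<lambda>i j. D1 h u i j * p1 i j + D1 h u (i - 1) j * p2 i j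
        + D2 h u i j * p3 i j + D2 h u i (j - 1) * p4 i j)"
proof -
  define X where "X i j = u (i + 1) j * p1 i j + u i j * p2 (i + 1) j" for i j
  define Y where "Y i j = u i (j + 1) * p3 i j + u i j * p4 i (j + 1)" for i j
  have X: "grid_periodic N X" and Y: "grid_periodic N Y"
    unfolding X_def Y_def by (intro grid_periodic_arith grid_periodic_shifts u p)+
  have "gsum N (\<lambda>i j. u i j * (1 / h * ((p1 i j - p1 (i - 1) j) + (p2 (i + 1) j - p2 i j)
      + (p3 i j - p3 i (j - 1)) + (p4 i (j + 1) - p4 i j))))
    + gsum N (\<lambda>i j. D1 h u i j * p1 i j + D1 h u (i - 1) j * p2 i j
        + D2 h u i j * p3 i j + D2 h u i (j - 1) * p4 i j)
    = gsum N (\<lambda>i j. ((X i j - X (i - 1) (j - 0)) + (Y i j - Y (i - 0) (j - 1))) / h)"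
    unfolding gsum_add[symmetric] X_def Y_def D1_def D2_def
    unfolding divide_inverse by (intro gsum_cong) (simp only: diff_add_cancel diff_zero, algebra)
  also have "\<dots> = 0"
    unfolding gsum_divide gsum_add gsum_telescope[OF X] gsum_telescope[OF Y] by simp
  finally show ?thesis by simp
qed

section \<open>The discrete system with continuous couplings\<close>

text \<open>The kernel \<open>K\<close> has no time and position arguments, as the congestion
  Hamiltonian is independent of them.\<close>

definition partial1 :: "(real \<Rightarrow> real \<Rightarrow> real \<Rightarrow> real \<Rightarrow> real \<Rightarrow> real) \<Rightarrow> real \<Rightarrow> real \<Rightarrow> real \<Rightarrow> real \<Rightarrow> real \<Rightarrow> real" where
  "partial1 K q1 q2 q3 q4 \<eta> = deriv (\<lambda>q. K q q2 q3 q4 \<eta>) q1"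

definition partial2 :: "(real \<Rightarrow> real \<Rightarrow> real \<Rightarrow> real \<Rightarrow> real \<Rightarrow> real) \<Rightarrow> real \<Rightarrow> real \<Rightarrow> real \<Rightarrow> real \<Rightarrow> real \<Rightarrow> real" where
  "partial2 K q1 q2 q3 q4 \<eta> = deriv (\<lambda>q. K q1 q q3 q4 \<eta>) q2"

definition partial3 :: "(real \<Rightarrow> real \<Rightarrow> real \<Rightarrow> real \<Rightarrow> real \<Rightarrow> real) \<Rightarrow> real \<Rightarrow> real \<Rightarrow> real \<Rightarrow> real \<Rightarrow> real \<Rightarrow> real" where
  "partial3 K q1 q2 q3 q4 \<eta> = deriv (\<lambda>q. K q1 q2 q q4 \<eta>) q3"

definition partial4 :: "(real \<Rightarrow> real \<Rightarrow> real \<Rightarrow> real \<Rightarrow> real \<Rightarrow> real) \<Rightarrow> real \<Rightarrow> real \<Rightarrow> real \<Rightarrow> real \<Rightarrow> real \<Rightarrow> real" where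
  "partial4 K q1 q2 q3 q4 \<eta> = deriv (\<lambda>q. K q1 q2 q3 q \<eta>) q4"

definition slope1 where
  "slope1 K h \<phi> \<eta> i j = on_Dh h \<phi> (\<lambda>q1 q2 q3 q4. partial1 K q1 q2 q3 q4 (\<eta> i j)) i j"

definition slope2 where
  "slope2 K h \<phi> \<eta> i j = on_Dh h \<phi> (\<lambda>q1 q2 q3 q4. partial2 K q1 q2 q3 q4 (\<eta> i j)) i j"

definition slope3 where
  "slope3 K h \<phi> \<eta> i j = on_Dh h \<phi> (\<lambda>q1 q2 q3 q4. partial3 K q1 q2 q3 q4 (\<eta> i j)) i j"

definition slope4 where
  "slope4 K h \<phi> \<eta> i j = on_Dh h \<phi> (\<lambda>q1 q2 q3 q4. partial4 K q1 q2 q3 q4 (\<eta> i j)) i j"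

lemmas slope_defs = slope1_def slope2_def slope3_def slope4_def

lemma P_eq_slope:
  "P1 (\<lambda>_ _. K) h t \<phi> \<rho> \<eta> i j = \<rho> i j * slope1 K h \<phi> \<eta> i j"
  "P2 (\<lambda>_ _. K) h t \<phi> \<rho> \<eta> i j = \<rho> i j * slope2 K h \<phi> \<eta> i j"
  "P3 (\<lambda>_ _. K) h t \<phi> \<rho> \<eta> i j = \<rho> i j * slope3 K h \<phi> \<eta> i j"
  "P4 (\<lambda>_ _. K) h t \<phi> \<rho> \<eta> i j = \<rho> i j * slope4 K h \<phi> \<eta> i j"
  by (simp_all add: P1_def P2_def P3_def P4_def slope_defs on_Dh_def
      partial1_def partial2_def partial3_def partial4_def)

lemma grid_periodic_on_Dh:
  assumes "grid_periodic N \<phi>" "grid_periodic N \<eta>"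
  shows "grid_periodic N (\<lambda>i j. on_Dh h \<phi> (\<lambda>q1 q2 q3 q4. F q1 q2 q3 q4 (\<eta> i j)) i j)"
  using grid_periodic_shifts(1)[OF assms(1), of 1] grid_periodic_shifts(2)[OF assms(1), of 1]
    grid_periodic_shifts(3)[OF assms(1), of 1] grid_periodic_shifts(4)[OF assms(1), of 1] assms
  by (simp add: grid_periodic_def on_Dh_def D1_def D2_def)

lemma grid_periodic_P:
  assumes "grid_periodic N \<phi>" "grid_periodic N \<rho>" "grid_periodic N \<eta>"
  shows "grid_periodic N (P1 (\<lambda>_ _. K) h t \<phi> \<rho> \<eta>)" "grid_periodic N (P2 (\<lambda>_ _. K) h t \<phi> \<rho> \<eta>)"
    "grid_periodic N (P3 (\<lambda>_ _. K) h t \<phi> \<rho> \<eta>)" "grid_periodic N (P4 (\<lambda>_ _. K) h t \<phi> \<rho> \<eta>)"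
  using grid_periodic_on_Dh[OF assms(1,3), of h "partial1 K"] grid_periodic_on_Dh[OF assms(1,3), of h "partial2 K"]
    grid_periodic_on_Dh[OF assms(1,3), of h "partial3 K"] grid_periodic_on_Dh[OF assms(1,3), of h "partial4 K"] assms(2)
  by (simp_all add: grid_periodic_def P_eq_slope slope_defs)

lemma grid_periodic_transport:
  assumes "grid_periodic N \<phi>" "grid_periodic N \<rho>" "grid_periodic N \<eta>"
  shows "grid_periodic N (transport_op (\<lambda>_ _. K) h t \<phi> \<rho> \<eta>)"
proof -
  note P = grid_periodic_P[OF assms, of K h t]
  show ?thesis
    using P grid_periodic_shifts(3)[OF P(1), of 1] grid_periodic_shifts(1)[OF P(2), of 1]
      grid_periodic_shifts(4)[OF P(3), of 1] grid_periodic_shifts(2)[OF P(4), of 1]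
    by (simp add: grid_periodic_def transport_op_def)
qed

lemma grid_periodic_laplacian:
  assumes "grid_periodic N u"
  shows "grid_periodic N (discrete_laplacian h u)"
  using grid_periodic_shifts(1)[OF assms, of 1] grid_periodic_shifts(2)[OF assms, of 1]
    grid_periodic_shifts(3)[OF assms, of 1] grid_periodic_shifts(4)[OF assms, of 1] assms
  by (simp add: grid_periodic_def discrete_laplacian_def)

lemma gsum_transport_by_parts:
  assumes "grid_periodic N \<phi>" "grid_periodic N \<rho>" "grid_periodic N \<eta>" "grid_periodic N u"
  shows "gsum N (\<lambda>i j. u i j * transport_op (\<lambda>_ _. K) h t \<phi> \<rho> \<eta> i j)
    = - gsum N (\<lambda>i j. \<rho> i j * (D1 h u i j * slope1 K h \<phi> \<eta> i j + D1 h u (i - 1) j * slope2 K h \<phi> \<eta> i j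
        + D2 h u i j * slope3 K h \<phi> \<eta> i j + D2 h u i (j - 1) * slope4 K h \<phi> \<eta> i j))"
  unfolding transport_op_def gsum_divergence[OF assms(4) grid_periodic_P[OF assms(1-3), of K h t]]
  by (simp add: P_eq_slope algebra_simps)

lemma gsum_transport:
  assumes "grid_periodic N \<phi>" "grid_periodic N \<rho>" "grid_periodic N \<eta>"
  shows "gsum N (transport_op (\<lambda>_ _. K) h t \<phi> \<rho> \<eta>) = 0"
  using gsum_transport_by_parts[OF assms, of "\<lambda>i j. 1" K h t]
  by (simp add: grid_periodic_def D1_def D2_def gsum_const)

text \<open>The terms are sorted by the values of \<rho>. If the slopes have the upwind signs, all
  four neighbour coefficients are nonnegative, which is the monotonicity of the scheme.\<close>

lemma transport_expand:
  "transport_op (\<lambda>_ _. K) h t \<phi> \<rho> \<eta> i j = 1 / h *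
    (\<rho> i j * (slope1 K h \<phi> \<eta> i j - slope2 K h \<phi> \<eta> i j + slope3 K h \<phi> \<eta> i j - slope4 K h \<phi> \<eta> i j)
     + \<rho> (i - 1) j * (- slope1 K h \<phi> \<eta> (i - 1) j) + \<rho> (i + 1) j * slope2 K h \<phi> \<eta> (i + 1) j
     + \<rho> i (j - 1) * (- slope3 K h \<phi> \<eta> i (j - 1)) + \<rho> i (j + 1) * slope4 K h \<phi> \<eta> i (j + 1))"
  by (simp add: transport_op_def P_eq_slope algebra_simps)

lemma finite_uniform_bound:
  fixes F :: "'a \<Rightarrow> 'b \<Rightarrow> real"
  assumes "finite S" "\<And>s. s \<in> S \<Longrightarrow> \<exists>B. \<forall>x\<in>X. F s x \<le> B"
  shows "\<exists>B. \<forall>s\<in>S. \<forall>x\<in>X. F s x \<le> B"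
  using assms
proof (induction S rule: finite_induct)
  case (insert s S)
  then obtain B B' where "\<forall>x\<in>X. F s x \<le> B" "\<forall>s\<in>S. \<forall>x\<in>X. F s x \<le> B'" by (meson insertCI)
  then have "\<forall>s'\<in>insert s S. \<forall>x\<in>X. F s' x \<le> max B B'" by (auto simp: le_max_iff_disj)
  then show ?case by blast
qed simp

text \<open>\<open>K_le_euler\<close> says that the running cost \<open>q \<bullet> \<partial>\<^sub>q K - K\<close> is nonnegative, and \<open>K_zero\<close> is the upwind
  property that makes \<open>K\<close> vanish at a minimum of the grid function.\<close>

locale hjb_hamiltonian =
  fixes K :: "real \<Rightarrow> real \<Rightarrow> real \<Rightarrow> real \<Rightarrow> real \<Rightarrow> real"
  assumes K_nonneg: "0 \<le> \<eta> \<Longrightarrow> 0 \<le> K q1 q2 q3 q4 \<eta>"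
    and K_zero: "0 \<le> \<eta> \<Longrightarrow> 0 \<le> q1 \<Longrightarrow> q2 \<le> 0 \<Longrightarrow> 0 \<le> q3 \<Longrightarrow> q4 \<le> 0 \<Longrightarrow> K q1 q2 q3 q4 \<eta> = 0"
    and partial_sign: "0 \<le> \<eta> \<Longrightarrow> partial1 K q1 q2 q3 q4 \<eta> \<le> 0" "0 \<le> \<eta> \<Longrightarrow> 0 \<le> partial2 K q1 q2 q3 q4 \<eta>"
      "0 \<le> \<eta> \<Longrightarrow> partial3 K q1 q2 q3 q4 \<eta> \<le> 0" "0 \<le> \<eta> \<Longrightarrow> 0 \<le> partial4 K q1 q2 q3 q4 \<eta>"
    and K_le_euler: "0 \<le> \<eta> \<Longrightarrow> K q1 q2 q3 q4 \<eta> \<le> q1 * partial1 K q1 q2 q3 q4 \<eta> + q2 * partial2 K q1 q2 q3 q4 \<eta>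
        + q3 * partial3 K q1 q2 q3 q4 \<eta> + q4 * partial4 K q1 q2 q3 q4 \<eta>"
    and continuous_K: "continuous_on {(q1, q2, q3, q4, \<eta>). 0 \<le> \<eta>} (\<lambda>(q1, q2, q3, q4, \<eta>). K q1 q2 q3 q4 \<eta>)"
    and continuous_partial:
      "continuous_on {(q1, q2, q3, q4, \<eta>). 0 \<le> \<eta>} (\<lambda>(q1, q2, q3, q4, \<eta>). partial1 K q1 q2 q3 q4 \<eta>)"
      "continuous_on {(q1, q2, q3, q4, \<eta>). 0 \<le> \<eta>} (\<lambda>(q1, q2, q3, q4, \<eta>). partial2 K q1 q2 q3 q4 \<eta>)"
      "continuous_on {(q1, q2, q3, q4, \<eta>). 0 \<le> \<eta>} (\<lambda>(q1, q2, q3, q4, \<eta>). partial3 K q1 q2 q3 q4 \<eta>)"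
      "continuous_on {(q1, q2, q3, q4, \<eta>). 0 \<le> \<eta>} (\<lambda>(q1, q2, q3, q4, \<eta>). partial4 K q1 q2 q3 q4 \<eta>)"
begin

lemma slope_sign:
  assumes "0 \<le> \<eta> i j"
  shows "slope1 K h \<phi> \<eta> i j \<le> 0" "0 \<le> slope2 K h \<phi> \<eta> i j"
    "slope3 K h \<phi> \<eta> i j \<le> 0" "0 \<le> slope4 K h \<phi> \<eta> i j"
  using partial_sign assms by (simp_all add: slope_defs on_Dh_def)

text \<open>The nonnegative neighbour terms of \<open>transport_expand\<close> are dropped.\<close>

lemma transport_ge:
  assumes h: "0 < h" and \<rho>: "\<And>i j. 0 \<le> \<rho> i j" and \<eta>: "\<And>i j. 0 \<le> \<eta> i j"
  shows "1 / h * (\<rho> i j * (slope1 K h \<phi> \<eta> i j - slope2 K h \<phi> \<eta> i j + slope3 K h \<phi> \<eta> i j - slope4 K h \<phi> \<eta> i j))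
    \<le> transport_op (\<lambda>_ _. K) h t \<phi> \<rho> \<eta> i j"
proof -
  have "0 \<le> \<rho> (i - 1) j * (- slope1 K h \<phi> \<eta> (i - 1) j)" "0 \<le> \<rho> (i + 1) j * slope2 K h \<phi> \<eta> (i + 1) j"
     "0 \<le> \<rho> i (j - 1) * (- slope3 K h \<phi> \<eta> i (j - 1))" "0 \<le> \<rho> i (j + 1) * slope4 K h \<phi> \<eta> i (j + 1)"
    by (intro mult_nonneg_nonneg; simp add: \<rho> slope_sign \<eta>)+
  then show ?thesis
    unfolding transport_expand using h by (intro mult_left_mono) auto
qed

text \<open>Continuous functions are bounded on compact sets. The set includes zero density, so
  continuity up to \<eta> = 0 matters here.\<close>

lemma partial_bounded:
  obtains C where "0 \<le> C" and "\<And>q1 q2 q3 q4 \<eta>. \<bar>q1\<bar> \<le> Q \<Longrightarrow> \<bar>q2\<bar> \<le> Q \<Longrightarrow> \<bar>q3\<bar> \<le> Q \<Longrightarrow> \<bar>q4\<bar> \<le> Q \<Longrightarrow> 0 \<le> \<eta> \<Longrightarrow> \<eta> \<le> E \<Longrightarrow>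
    \<bar>partial1 K q1 q2 q3 q4 \<eta>\<bar> \<le> C \<and> \<bar>partial2 K q1 q2 q3 q4 \<eta>\<bar> \<le> C \<and>
    \<bar>partial3 K q1 q2 q3 q4 \<eta>\<bar> \<le> C \<and> \<bar>partial4 K q1 q2 q3 q4 \<eta>\<bar> \<le> C"
proof -
  define S where "S = {-Q..Q} \<times> {-Q..Q} \<times> {-Q..Q} \<times> {-Q..Q} \<times> {0..E}"
  have S: "compact S" unfolding S_def by (intro compact_Times compact_Icc)
  have sub: "S \<subseteq> {(q1, q2, q3, q4, \<eta>). 0 \<le> \<eta>}" by (auto simp: S_def)
  have "\<exists>B. \<forall>x\<in>S. \<bar>F x\<bar> \<le> B" if "continuous_on {(q1, q2, q3, q4, \<eta>). 0 \<le> \<eta>} F" for F :: "_ \<Rightarrow> real"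
    using compact_imp_bounded[OF compact_continuous_image[OF continuous_on_subset[OF that sub] S]]
    by (auto simp: bounded_iff)
  from this[OF continuous_partial(1)] this[OF continuous_partial(2)]
    this[OF continuous_partial(3)] this[OF continuous_partial(4)]
  obtain B1 B2 B3 B4 where B:
    "\<And>x. x \<in> S \<Longrightarrow> \<bar>case x of (q1, q2, q3, q4, \<eta>) \<Rightarrow> partial1 K q1 q2 q3 q4 \<eta>\<bar> \<le> B1"
    "\<And>x. x \<in> S \<Longrightarrow> \<bar>case x of (q1, q2, q3, q4, \<eta>) \<Rightarrow> partial2 K q1 q2 q3 q4 \<eta>\<bar> \<le> B2"
    "\<And>x. x \<in> S \<Longrightarrow> \<bar>case x of (q1, q2, q3, q4, \<eta>) \<Rightarrow> partial3 K q1 q2 q3 q4 \<eta>\<bar> \<le> B3"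
    "\<And>x. x \<in> S \<Longrightarrow> \<bar>case x of (q1, q2, q3, q4, \<eta>) \<Rightarrow> partial4 K q1 q2 q3 q4 \<eta>\<bar> \<le> B4"
    by blast
  show thesis
  proof (rule that[of "\<bar>B1\<bar> + \<bar>B2\<bar> + \<bar>B3\<bar> + \<bar>B4\<bar>"])
    fix q1 q2 q3 q4 \<eta> assume "\<bar>q1\<bar> \<le> Q" "\<bar>q2\<bar> \<le> Q" "\<bar>q3\<bar> \<le> Q" "\<bar>q4\<bar> \<le> Q" "0 \<le> \<eta>" "\<eta> \<le> E"
    then have "(q1, q2, q3, q4, \<eta>) \<in> S" by (auto simp: S_def)
    from B[OF this] show "\<bar>partial1 K q1 q2 q3 q4 \<eta>\<bar> \<le> \<bar>B1\<bar> + \<bar>B2\<bar> + \<bar>B3\<bar> + \<bar>B4\<bar> \<and>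
      \<bar>partial2 K q1 q2 q3 q4 \<eta>\<bar> \<le> \<bar>B1\<bar> + \<bar>B2\<bar> + \<bar>B3\<bar> + \<bar>B4\<bar> \<and>
      \<bar>partial3 K q1 q2 q3 q4 \<eta>\<bar> \<le> \<bar>B1\<bar> + \<bar>B2\<bar> + \<bar>B3\<bar> + \<bar>B4\<bar> \<and>
      \<bar>partial4 K q1 q2 q3 q4 \<eta>\<bar> \<le> \<bar>B1\<bar> + \<bar>B2\<bar> + \<bar>B3\<bar> + \<bar>B4\<bar>" by auto
  qed simp
qed

text \<open>At a maximum the Laplacian is nonpositive, and \<open>K\<close> is nonnegative
  anyway.\<close>

lemma hjb_at_max:
  assumes \<nu>: "0 < \<nu>" and \<eta>: "0 \<le> \<eta>"
    and max: "\<And>i' j'. \<phi> i' j' \<le> \<phi> i j"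
  shows "0 \<le> - \<nu> * discrete_laplacian h \<phi> i j + on_Dh h \<phi> (\<lambda>q1 q2 q3 q4. K q1 q2 q3 q4 \<eta>) i j"
proof -
  have "discrete_laplacian h \<phi> i j \<le> 0"
    unfolding discrete_laplacian_def
    using max[of "i - 1" j] max[of "i + 1" j] max[of i "j - 1"] max[of i "j + 1"]
    by (intro divide_nonpos_nonneg) auto
  then have "0 \<le> - \<nu> * discrete_laplacian h \<phi> i j"
    using \<nu> by (simp add: mult_nonneg_nonpos)
  moreover have "0 \<le> on_Dh h \<phi> (\<lambda>q1 q2 q3 q4. K q1 q2 q3 q4 \<eta>) i j"
    by (simp add: on_Dh_def K_nonneg[OF \<eta>])
  ultimately show ?thesis by linarith
qed

text \<open>At a minimum the forward differences are nonnegative and the backward ones nonpositive.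
  These are the signs that upwinding ignores, so \<open>K_zero\<close> applies, while the Laplacian
  is nonnegative.\<close>

lemma hjb_at_min:
  assumes h: "0 < h" and \<nu>: "0 < \<nu>" and \<eta>: "0 \<le> \<eta>"
    and min: "\<And>i' j'. \<phi> i j \<le> \<phi> i' j'"
  shows "- \<nu> * discrete_laplacian h \<phi> i j + on_Dh h \<phi> (\<lambda>q1 q2 q3 q4. K q1 q2 q3 q4 \<eta>) i j \<le> 0"
proof -
  have "0 \<le> discrete_laplacian h \<phi> i j"
    unfolding discrete_laplacian_def
    using min[of "i - 1" j] min[of "i + 1" j] min[of i "j - 1"] min[of i "j + 1"]
    by (intro divide_nonneg_nonneg) auto
  moreover have "on_Dh h \<phi> (\<lambda>q1 q2 q3 q4. K q1 q2 q3 q4 \<eta>) i j = 0"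
    unfolding on_Dh_def
    using min[of "i - 1" j] min[of "i + 1" j] min[of i "j - 1"] min[of i "j + 1"] h
    by (intro K_zero \<eta>) (simp_all add: D1_def D2_def divide_nonpos_nonneg)
  ultimately show ?thesis using \<nu> by simp
qed

end

section \<open>Mass balance and Harnack inequality for the density equation\<close>

locale discrete_mfg = hjb_hamiltonian K for K +
  fixes N NT :: nat and h dt \<nu> :: real and \<rho>0 :: "real \<times> real \<Rightarrow> real"
  assumes h: "0 < h" and dt: "0 < dt" and \<nu>: "0 < \<nu>" and Nh: "real N * h = 1" and NT: "0 < NT"
    and \<rho>0: "torus_prob_density \<rho>0"
begin

lemma N_pos: "0 < N" using Nh by (cases N) auto

abbreviation grid :: "int set" where "grid \<equiv> {0..<int N}"

lemma mod_grid: "i mod int N \<in> grid" using N_pos by simp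

definition mass :: real where "mass = gsum N (cell_average h \<rho>0)"

lemma mass_pos: "0 < mass"
proof -
  obtain i j where ij: "i \<in> grid" "j \<in> grid" "0 < cell_average h \<rho>0 i j"
    using cell_average_pos[OF \<rho>0 h Nh] .
  have "cell_average h \<rho>0 i j \<le> mass"
    unfolding mass_def by (rule gsum_member_le) (use cell_average_nonneg[OF \<rho>0 h] ij in auto)
  with ij show ?thesis by simp
qed

definition fp_residual :: "(nat \<Rightarrow> grid_fun) \<Rightarrow> (nat \<Rightarrow> grid_fun) \<Rightarrow> nat \<Rightarrow> grid_fun" where
  "fp_residual \<phi> \<rho> k i j = Dt dt \<rho> k i j - \<nu> * discrete_laplacian h (\<rho> (Suc k)) i j
     - transport_op (\<lambda>_ _. K) h (real k * dt) (\<phi> k) (\<rho> (Suc k)) (\<rho> (Suc k)) i j"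

text \<open>The Laplacian and the transport term are discrete divergences and sum to zero, so only
  the time increment remains.\<close>

lemma gsum_fp_residual:
  assumes "grid_periodic N (\<phi> k)" "grid_periodic N (\<rho> (Suc k))"
  shows "gsum N (fp_residual \<phi> \<rho> k) = (gsum N (\<rho> (Suc k)) - gsum N (\<rho> k)) / dt"
  unfolding fp_residual_def[abs_def] gsum_diff gsum_scale Dt_def gsum_divide
  using gsum_laplacian[OF assms(2)] gsum_transport[OF assms(1) assms(2,2)] by simp

text \<open>Where the new density vanishes, so do the diagonal terms; the neighbours enter the
  residual with nonpositive coefficients, and so does the old density.\<close>

lemma fp_residual_nonpos_at_zero:
  assumes "\<And>i j. 0 \<le> \<rho> (Suc k) i j" "0 \<le> \<rho> k i j" "\<rho> (Suc k) i j = 0"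
  shows "fp_residual \<phi> \<rho> k i j \<le> 0"
proof -
  have "Dt dt \<rho> k i j \<le> 0" using assms dt by (simp add: Dt_def divide_nonpos_pos)
  moreover have "0 \<le> \<nu> * discrete_laplacian h (\<rho> (Suc k)) i j"
    using assms \<nu> by (simp add: discrete_laplacian_def)
  moreover have "0 \<le> transport_op (\<lambda>_ _. K) h (real k * dt) (\<phi> k) (\<rho> (Suc k)) (\<rho> (Suc k)) i j"
    using transport_ge[where \<rho> = "\<rho> (Suc k)" and \<eta> = "\<rho> (Suc k)" and i = i and j = j and \<phi> = "\<phi> k"
          and t = "real k * dt", OF h assms(1) assms(1)] assms(3) by simp
  ultimately show ?thesis by (simp add: fp_residual_def)
qed

lemma abs_on_Dh_args:
  assumes "\<And>i j. \<bar>u i j\<bar> \<le> M"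
  shows "\<bar>D1 h u i j\<bar> \<le> 2 * M / h" "\<bar>D2 h u i j\<bar> \<le> 2 * M / h"
proof -
  have "\<bar>u (i + 1) j - u i j\<bar> \<le> 2 * M" "\<bar>u i (j + 1) - u i j\<bar> \<le> 2 * M"
    using assms[of "i + 1" j] assms[of i j] assms[of i "j + 1"] by linarith+
  then show "\<bar>D1 h u i j\<bar> \<le> 2 * M / h" "\<bar>D2 h u i j\<bar> \<le> 2 * M / h"
    using h by (simp_all add: D1_def D2_def divide_right_mono)
qed

text \<open>Solved for the new density at a point, the equation has a diagonal coefficient of at
  most \<open>1 / dt + \<nu> / h^2 + 4 * C / h\<close>, and each neighbour has a coefficient of at
  least \<open>\<nu> / (4 * h^2)\<close>. So each value is at least \<theta> times any neighbouring
  value. Chaining this along a path of at most \<open>2 * N\<close> steps and averaging over the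
  other end point gives the bound by the mass.\<close>

lemma harnack:
  assumes per: "grid_periodic N (\<phi> k)" "grid_periodic N (\<rho> (Suc k))" "grid_periodic N (\<rho> k)"
    and nn: "\<And>i j. 0 \<le> \<rho> k i j" "\<And>i j. 0 \<le> \<rho> (Suc k) i j"
    and eq: "\<And>i j. i \<in> grid \<Longrightarrow> j \<in> grid \<Longrightarrow> fp_residual \<phi> \<rho> k i j = 0"
    and C: "0 \<le> C" "\<And>i j. \<bar>slope1 K h (\<phi> k) (\<rho> (Suc k)) i j\<bar> \<le> C" "\<And>i j. \<bar>slope2 K h (\<phi> k) (\<rho> (Suc k)) i j\<bar> \<le> C"
      "\<And>i j. \<bar>slope3 K h (\<phi> k) (\<rho> (Suc k)) i j\<bar> \<le> C" "\<And>i j. \<bar>slope4 K h (\<phi> k) (\<rho> (Suc k)) i j\<bar> \<le> C"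
    and \<theta>: "\<theta> = \<nu> / (4 * h\<^sup>2) / (1 / dt + \<nu> / h\<^sup>2 + 4 * C / h)"
  shows "\<theta> ^ (2 * N) * gsum N (\<rho> (Suc k)) / (real N)\<^sup>2 \<le> \<rho> (Suc k) i j"
proof -
  let ?w = "\<rho> (Suc k)"
  let ?D = "1 / dt + \<nu> / h\<^sup>2 + 4 * C / h"
  have D: "0 < ?D" using h dt \<nu> C(1) by (intro add_pos_nonneg add_pos_pos) auto
  have \<theta>0: "0 < \<theta>" unfolding \<theta> using D h \<nu> by (intro divide_pos_pos) auto
  have "\<nu> / (4 * h\<^sup>2) \<le> \<nu> / h\<^sup>2" using h \<nu> by (intro divide_left_mono) auto
  then have "\<nu> / (4 * h\<^sup>2) \<le> ?D" using h dt C(1) by (simp add: add_increasing add_increasing2)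
  then have \<theta>1: "\<theta> \<le> 1" unfolding \<theta> using D divide_le_eq_1_pos by blast
  have per_res: "fp_residual \<phi> \<rho> k i j = fp_residual \<phi> \<rho> k (i mod int N) (j mod int N)" for i j
  proof -
    have "grid_periodic N (fp_residual \<phi> \<rho> k)"
      using per grid_periodic_laplacian[OF per(2)] grid_periodic_transport[OF per(1,2,2)]
      by (simp add: grid_periodic_def fp_residual_def Dt_def)
    from grid_periodic_mod[OF this] show ?thesis by simp
  qed
  \<comment> \<open>By periodicity the equation holds at all integer indices, so that paths may
    leave the fundamental domain.\<close>
  have eq': "fp_residual \<phi> \<rho> k i j = 0" for i j
    using per_res[of i j] eq[OF mod_grid mod_grid] by simp
  \<comment> \<open>The old density and the neighbour contributions of the transport term are
    nonnegative and are discarded; only diffusion links the neighbours here.\<close>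
  have nb: "\<theta> * (?w (i - 1) j + ?w (i + 1) j + ?w i (j - 1) + ?w i (j + 1)) \<le> ?w i j" for i j
  proof -
    let ?n = "?w (i - 1) j + ?w (i + 1) j + ?w i (j - 1) + ?w i (j + 1)"
    let ?s = "slope1 K h (\<phi> k) ?w i j - slope2 K h (\<phi> k) ?w i j + slope3 K h (\<phi> k) ?w i j - slope4 K h (\<phi> k) ?w i j"
    have "- (4 * C) \<le> ?s" using C(2-5)[of i j] by linarith
    then have "1 / h * (?w i j * (- (4 * C))) \<le> 1 / h * (?w i j * ?s)"
      using h nn(2) by (intro mult_left_mono) auto
    also have "\<dots> \<le> transport_op (\<lambda>_ _. K) h (real k * dt) (\<phi> k) ?w ?w i j"
      by (intro transport_ge h nn)
    also have "\<dots> = (?w i j - \<rho> k i j) / dt - \<nu> * ((?n - 4 * ?w i j) / (4 * h\<^sup>2))"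
      using eq'[of i j] by (simp add: fp_residual_def Dt_def discrete_laplacian_def)
    finally have "\<nu> / (4 * h\<^sup>2) * ?n + \<rho> k i j / dt \<le> ?w i j * ?D"
      by (simp add: algebra_simps diff_divide_distrib add_divide_distrib)
    moreover have "0 \<le> \<rho> k i j / dt" using nn(1) dt by simp
    ultimately have "\<nu> / (4 * h\<^sup>2) * ?n \<le> ?w i j * ?D" by linarith
    then have "\<nu> / (4 * h\<^sup>2) * ?n / ?D \<le> ?w i j" using D pos_divide_le_eq by blast
    then show ?thesis by (simp only: \<theta> times_divide_eq_left)
  qed
  have step: "\<theta> * ?w (i + 1) j \<le> ?w i j" "\<theta> * ?w i (j + 1) \<le> ?w i j" for i j
  proof -
    have "?w (i + 1) j \<le> ?w (i - 1) j + ?w (i + 1) j + ?w i (j - 1) + ?w i (j + 1)"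
      "?w i (j + 1) \<le> ?w (i - 1) j + ?w (i + 1) j + ?w i (j - 1) + ?w i (j + 1)"
      using nn(2)[of "i - 1" j] nn(2)[of "i + 1" j] nn(2)[of i "j - 1"] nn(2)[of i "j + 1"] by linarith+
    from this[THEN mult_left_mono, of \<theta>] nb[of i j] \<theta>0
    show "\<theta> * ?w (i + 1) j \<le> ?w i j" "\<theta> * ?w i (j + 1) \<le> ?w i j" by linarith+
  qed
  have s1: "\<theta> ^ m * ?w (i + int m) j \<le> ?w i j" for m i j
  proof (induction m arbitrary: i)
    case (Suc m)
    have "\<theta> ^ Suc m * ?w (i + int (Suc m)) j = \<theta> * (\<theta> ^ m * ?w (i + 1 + int m) j)"
      by (simp add: add_ac)
    also have "\<dots> \<le> \<theta> * ?w (i + 1) j" using Suc.IH[of "i + 1"] \<theta>0 by (intro mult_left_mono) auto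
    also have "\<dots> \<le> ?w i j" by (rule step)
    finally show ?case .
  qed simp
  have s2: "\<theta> ^ m * ?w i (j + int m) \<le> ?w i j" for m i j
  proof (induction m arbitrary: j)
    case (Suc m)
    have "\<theta> ^ Suc m * ?w i (j + int (Suc m)) = \<theta> * (\<theta> ^ m * ?w i (j + 1 + int m))"
      by (simp add: add_ac)
    also have "\<dots> \<le> \<theta> * ?w i (j + 1)" using Suc.IH[of "j + 1"] \<theta>0 by (intro mult_left_mono) auto
    also have "\<dots> \<le> ?w i j" by (rule step)
    finally show ?case .
  qed simp
  have far: "\<theta> ^ (2 * N) * ?w i' j' \<le> ?w i j" for i' j'
  proof -
    \<comment> \<open>The path goes only in the two positive directions, and periodicity keeps it
      shorter than \<open>N\<close> steps in each of them.\<close>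
    define m n where "m = nat ((i' - i) mod int N)" and "n = nat ((j' - j) mod int N)"
    have mn: "int m = (i' - i) mod int N" "int n = (j' - j) mod int N" "m \<le> N" "n \<le> N"
      using N_pos by (auto simp: m_def n_def nat_le_iff intro: less_imp_le)
    have "?w (i + int m) (j + int n) = ?w ((i + int m) mod int N) ((j + int n) mod int N)"
      using grid_periodic_mod[OF per(2)] by simp
    also have "\<dots> = ?w (i' mod int N) (j' mod int N)" by (simp add: mn mod_add_right_eq)
    also have "\<dots> = ?w i' j'" using grid_periodic_mod[OF per(2)] by simp
    finally have e: "?w (i + int m) (j + int n) = ?w i' j'" .
    have "\<theta> ^ (2 * N) \<le> \<theta> ^ (m + n)" using mn \<theta>0 \<theta>1 by (intro power_decreasing) auto
    then have "\<theta> ^ (2 * N) * ?w i' j' \<le> \<theta> ^ (m + n) * ?w i' j'"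
      using nn(2) by (intro mult_right_mono) auto
    also have "\<dots> = \<theta> ^ m * (\<theta> ^ n * ?w (i + int m) (j + int n))"
      by (simp add: e power_add)
    also have "\<dots> \<le> \<theta> ^ m * ?w (i + int m) j" using s2 \<theta>0 by (intro mult_left_mono) auto
    also have "\<dots> \<le> ?w i j" by (rule s1)
    finally show ?thesis .
  qed
  have "\<theta> ^ (2 * N) * gsum N ?w \<le> (real N)\<^sup>2 * ?w i j"
    unfolding gsum_scale[symmetric] gsum_const[symmetric] by (rule gsum_mono) (rule far)
  then show ?thesis using N_pos by (simp add: pos_divide_le_eq mult.commute)
qed

end

section \<open>Solutions of the system and uniform lower bounds on the density\<close>

context discrete_mfg begin

text \<open>The density half of the system, with nonnegativity only. The couplings do not occur, so
  estimates derived from it are uniform in their truncation.\<close>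

definition fp_solution :: "(nat \<Rightarrow> grid_fun) \<Rightarrow> (nat \<Rightarrow> grid_fun) \<Rightarrow> bool" where
  "fp_solution \<phi> \<rho> \<longleftrightarrow>
     (\<forall>k\<le>NT. grid_periodic N (\<phi> k) \<and> grid_periodic N (\<rho> k)) \<and>
     (\<forall>k\<le>NT. \<forall>i j. 0 \<le> \<rho> k i j) \<and>
     (\<forall>i\<in>grid. \<forall>j\<in>grid. \<rho> 0 i j = cell_average h \<rho>0 i j) \<and>
     (\<forall>k<NT. \<forall>i\<in>grid. \<forall>j\<in>grid. fp_residual \<phi> \<rho> k i j = 0)"

lemma fp_solution_mass:
  assumes "fp_solution \<phi> \<rho>" "k \<le> NT"
  shows "gsum N (\<rho> k) = mass"
  using assms(2)
proof (induction k)
  case 0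
  then show ?case using assms(1) unfolding mass_def fp_solution_def by (intro gsum_cong) auto
next
  case (Suc k)
  have "gsum N (fp_residual \<phi> \<rho> k) = gsum N (\<lambda>i j. 0)"
    using assms(1) Suc.prems unfolding fp_solution_def by (intro gsum_cong) auto
  moreover have "gsum N (fp_residual \<phi> \<rho> k) = (gsum N (\<rho> (Suc k)) - gsum N (\<rho> k)) / dt"
    using assms(1) Suc.prems unfolding fp_solution_def by (intro gsum_fp_residual) auto
  ultimately show ?case using Suc dt by (simp add: gsum_const)
qed

lemma fp_solution_le_mass:
  assumes "fp_solution \<phi> \<rho>" "k \<le> NT"
  shows "\<rho> k i j \<le> mass"
proof -
  have per: "grid_periodic N (\<rho> k)" and nn: "\<And>i j. 0 \<le> \<rho> k i j"
    using assms by (auto simp: fp_solution_def)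
  have "\<rho> k (i mod int N) (j mod int N) \<le> gsum N (\<rho> k)"
    by (rule gsum_member_le) (use nn mod_grid in auto)
  then show ?thesis using grid_periodic_mod[OF per] fp_solution_mass[OF assms] by simp
qed

text \<open>The constant is fixed before \<phi> and \<rho> and depends on \<phi> only through
  \<open>M\<close>. A bound on \<phi> bounds its differences, and the densities are at most
  \<open>mass\<close>; by compactness this bounds the slopes. The Harnack inequality and
  conservation of mass do the rest.\<close>

lemma fp_solution_lower_bound:
  obtains c where "0 < c"
    and "\<And>\<phi> \<rho> k i j. fp_solution \<phi> \<rho> \<Longrightarrow> k < NT \<Longrightarrow> (\<And>i j. \<bar>\<phi> k i j\<bar> \<le> M) \<Longrightarrow> c \<le> \<rho> (Suc k) i j"
proof -
  obtain C where C: "0 \<le> C" and bound: "\<And>q1 q2 q3 q4 \<eta>. \<bar>q1\<bar> \<le> 2 * M / h \<Longrightarrow> \<bar>q2\<bar> \<le> 2 * M / h \<Longrightarrow>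
      \<bar>q3\<bar> \<le> 2 * M / h \<Longrightarrow> \<bar>q4\<bar> \<le> 2 * M / h \<Longrightarrow> 0 \<le> \<eta> \<Longrightarrow> \<eta> \<le> mass \<Longrightarrow>
    \<bar>partial1 K q1 q2 q3 q4 \<eta>\<bar> \<le> C \<and> \<bar>partial2 K q1 q2 q3 q4 \<eta>\<bar> \<le> C \<and>
    \<bar>partial3 K q1 q2 q3 q4 \<eta>\<bar> \<le> C \<and> \<bar>partial4 K q1 q2 q3 q4 \<eta>\<bar> \<le> C"
    using partial_bounded[of "2 * M / h" mass] by blast
  define \<theta> where "\<theta> = \<nu> / (4 * h\<^sup>2) / (1 / dt + \<nu> / h\<^sup>2 + 4 * C / h)"
  have "0 < \<theta>"
    unfolding \<theta>_def using h dt \<nu> C by (intro divide_pos_pos add_pos_nonneg add_pos_pos) auto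
  then have "0 < \<theta> ^ (2 * N) * mass / (real N)\<^sup>2"
    using mass_pos N_pos by simp
  moreover have "\<theta> ^ (2 * N) * mass / (real N)\<^sup>2 \<le> \<rho> (Suc k) i j"
    if sol: "fp_solution \<phi> \<rho>" and k: "k < NT" and M: "\<And>i j. \<bar>\<phi> k i j\<bar> \<le> M" for \<phi> \<rho> k i j
  proof -
    have nn: "0 \<le> \<rho> (Suc k) i j" for i j using sol k by (auto simp: fp_solution_def)
    note b = bound[OF abs_on_Dh_args(1)[OF M] abs_on_Dh_args(1)[OF M] abs_on_Dh_args(2)[OF M]
        abs_on_Dh_args(2)[OF M] nn fp_solution_le_mass[OF sol]]
    have "\<theta> ^ (2 * N) * gsum N (\<rho> (Suc k)) / (real N)\<^sup>2 \<le> \<rho> (Suc k) i j"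
    proof (rule harnack[where C = C and \<phi> = \<phi> and k = k])
      show "\<bar>slope1 K h (\<phi> k) (\<rho> (Suc k)) i j\<bar> \<le> C" "\<bar>slope2 K h (\<phi> k) (\<rho> (Suc k)) i j\<bar> \<le> C"
        "\<bar>slope3 K h (\<phi> k) (\<rho> (Suc k)) i j\<bar> \<le> C" "\<bar>slope4 K h (\<phi> k) (\<rho> (Suc k)) i j\<bar> \<le> C" for i j
        using b k unfolding slope_defs on_Dh_def by simp_all
    qed (use sol k C nn in \<open>auto simp: fp_solution_def \<theta>_def\<close>)
    then show ?thesis using fp_solution_mass[OF sol, of "Suc k"] k by simp
  qed
  ultimately show thesis by (rule that)
qed

abbreviation solution where
  "solution f g \<phi> \<rho> \<equiv> discrete_mfg_solution (\<lambda>_ _. K) h N dt NT \<nu> f g \<rho>0 \<phi> \<rho>"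

definition hjb_residual where
  "hjb_residual f \<phi> \<rho> k i j = - Dt dt \<phi> k i j - \<nu> * discrete_laplacian h (\<phi> k) i j
     + on_Dh h (\<phi> k) (\<lambda>q1 q2 q3 q4. K q1 q2 q3 q4 (\<rho> (Suc k) i j)) i j
     - f (real k * dt) (grid_point h i j) (\<rho> (Suc k) i j)"

text \<open>Strict positivity does not have to be supplied: it follows from the lower bound once
  \<phi> is bounded.\<close>

lemma solutionI:
  assumes "fp_solution \<phi> \<rho>"
    and "\<And>k i j. k < NT \<Longrightarrow> i \<in> grid \<Longrightarrow> j \<in> grid \<Longrightarrow> hjb_residual f \<phi> \<rho> k i j = 0"
    and "\<And>i j. i \<in> grid \<Longrightarrow> j \<in> grid \<Longrightarrow> \<phi> NT i j = g (grid_point h i j) (\<rho> NT i j)"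
    and M: "\<And>k i j. k < NT \<Longrightarrow> \<bar>\<phi> k i j\<bar> \<le> M"
  shows "solution f g \<phi> \<rho>"
proof -
  obtain c where "0 < c" "\<And>\<phi> \<rho> k i j. fp_solution \<phi> \<rho> \<Longrightarrow> k < NT \<Longrightarrow> (\<And>i j. \<bar>\<phi> k i j\<bar> \<le> M) \<Longrightarrow> c \<le> \<rho> (Suc k) i j"
    using fp_solution_lower_bound[of M] by blast
  then have "0 < \<rho> (Suc k) i j" if "k < NT" for k i j
    using assms(1) M that by (meson less_le_trans)
  then show ?thesis
    using assms(1-3) unfolding discrete_mfg_solution_def fp_solution_def hjb_residual_def fp_residual_def
    by simp
qed

lemma solution_periodic:
  assumes "solution f g \<phi> \<rho>" "k \<le> NT"
  shows "grid_periodic N (\<phi> k)" "grid_periodic N (\<rho> k)"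
  using assms unfolding discrete_mfg_solution_def by blast+

lemma solution_pos:
  assumes "solution f g \<phi> \<rho>" "k < NT"
  shows "0 < \<rho> (Suc k) i j"
proof -
  have "0 < \<rho> (Suc k) (i mod int N) (j mod int N)"
    using assms mod_grid unfolding discrete_mfg_solution_def by blast
  then show ?thesis
    using grid_periodic_mod[OF solution_periodic(2)[OF assms(1), of "Suc k"]] assms(2) by simp
qed

lemma solution_initial_grid:
  assumes "solution f g \<phi> \<rho>" "i \<in> grid" "j \<in> grid"
  shows "\<rho> 0 i j = cell_average h \<rho>0 i j"
  using assms unfolding discrete_mfg_solution_def by simp

lemma solution_initial:
  assumes "solution f g \<phi> \<rho>"
  shows "\<rho> 0 i j = cell_average h \<rho>0 (i mod int N) (j mod int N)"
proof -
  have "\<rho> 0 i j = \<rho> 0 (i mod int N) (j mod int N)"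
    by (rule grid_periodic_mod[symmetric]) (rule solution_periodic(2)[OF assms], simp)
  also have "\<dots> = cell_average h \<rho>0 (i mod int N) (j mod int N)"
    by (rule solution_initial_grid[OF assms mod_grid mod_grid])
  finally show ?thesis .
qed

lemma solution_fp:
  assumes "solution f g \<phi> \<rho>"
  shows "fp_solution \<phi> \<rho>"
  unfolding fp_solution_def
proof (intro conjI allI impI ballI)
  fix k i j assume k: "k \<le> NT"
  show "0 \<le> \<rho> k i j"
  proof (cases k)
    case 0
    then show ?thesis using solution_initial[OF assms] cell_average_nonneg[OF \<rho>0 h] by simp
  next
    case (Suc l)
    then show ?thesis using solution_pos[OF assms, of l i j] k by simp
  qed
next
  fix i j assume "i \<in> grid" "j \<in> grid"
  then show "\<rho> 0 i j = cell_average h \<rho>0 i j"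
    by (rule solution_initial_grid[OF assms])
next
  fix k i j assume "k < NT" "i \<in> grid" "j \<in> grid"
  then show "fp_residual \<phi> \<rho> k i j = 0"
    using assms unfolding discrete_mfg_solution_def fp_residual_def by simp
qed (use solution_periodic[OF assms] in blast)+

lemma solution_hjb:
  assumes "solution f g \<phi> \<rho>" "k < NT" "i \<in> grid" "j \<in> grid"
  shows "hjb_residual f \<phi> \<rho> k i j = 0"
  using assms unfolding discrete_mfg_solution_def hjb_residual_def by simp

lemma solution_terminal:
  assumes "solution f g \<phi> \<rho>" "i \<in> grid" "j \<in> grid"
  shows "\<phi> NT i j = g (grid_point h i j) (\<rho> NT i j)"
  using assms unfolding discrete_mfg_solution_def by simp

section \<open>The discrete maximum principle for the Hamilton-Jacobi equation\<close>

lemma grid_argmax: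
  assumes "grid_periodic N u"
  obtains i j where "i \<in> grid" "j \<in> grid" "\<And>i' j'. u i' j' \<le> (u i j :: real)"
proof -
  have fin: "finite ((\<lambda>(i, j). u i j) ` (grid \<times> grid))" and ne: "(\<lambda>(i, j). u i j) ` (grid \<times> grid) \<noteq> {}"
    using N_pos by auto
  obtain p where p: "p \<in> grid \<times> grid" "Max ((\<lambda>(i, j). u i j) ` (grid \<times> grid)) = (\<lambda>(i, j). u i j) p"
    using Max_in[OF fin ne] by blast
  show thesis
  proof (rule that[of "fst p" "snd p"])
    fix i' j'
    have "u (i' mod int N) (j' mod int N) \<le> Max ((\<lambda>(i, j). u i j) ` (grid \<times> grid))"
      using mod_grid by (intro Max_ge fin) force
    then show "u i' j' \<le> u (fst p) (snd p)"
      using p grid_periodic_mod[OF assms] by (simp add: case_prod_beta)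
  qed (use p in auto)
qed

text \<open>The induction runs backwards from the terminal time. At an extremum of \<phi> over the
  grid the spatial part of the equation has a sign, so each step changes the bound by at most
  \<open>A * dt\<close>.\<close>

lemma hjb_maximum_principle:
  assumes per: "\<And>k. k \<le> NT \<Longrightarrow> grid_periodic N (\<phi> k)" and \<rho>: "\<And>k i j. k < NT \<Longrightarrow> 0 \<le> \<rho> (Suc k) i j"
    and eq: "\<And>k i j. k < NT \<Longrightarrow> i \<in> grid \<Longrightarrow> j \<in> grid \<Longrightarrow> hjb_residual f \<phi> \<rho> k i j = 0"
    and f: "\<And>k i j. k < NT \<Longrightarrow> i \<in> grid \<Longrightarrow> j \<in> grid \<Longrightarrow>
      \<bar>f (real k * dt) (grid_point h i j) (\<rho> (Suc k) i j)\<bar> \<le> A"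
    and \<phi>: "\<And>i j. i \<in> grid \<Longrightarrow> j \<in> grid \<Longrightarrow> \<bar>\<phi> NT i j\<bar> \<le> A"
    and k: "k \<le> NT"
  shows "\<bar>\<phi> k i j\<bar> \<le> A * (1 + real NT * dt)"
proof -
  have A: "0 \<le> A" using \<phi>[OF mod_grid mod_grid] by (meson abs_ge_zero order_trans)
  have "\<bar>\<phi> (NT - n) i j\<bar> \<le> A * (1 + real n * dt)" if "n \<le> NT" for n i j
    using that
  proof (induction n arbitrary: i j)
    case 0
    then show ?case
      using \<phi>[OF mod_grid[of i] mod_grid[of j]] grid_periodic_mod[OF per[of NT]] by simp
  next
    case (Suc n)
    define k where "k = NT - Suc n"
    have k: "k < NT" "Suc k = NT - n" using Suc.prems by (auto simp: k_def)
    have nxt: "\<bar>\<phi> (Suc k) i j\<bar> \<le> A * (1 + real n * dt)" for i j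
      using Suc k by simp
    have D: "- Dt dt \<phi> k i j = (\<phi> k i j - \<phi> (Suc k) i j) / dt" for i j
      by (simp add: Dt_def minus_divide_left)
    obtain a b where ab: "a \<in> grid" "b \<in> grid" and mx: "\<And>i j. \<phi> k i j \<le> \<phi> k a b"
      using grid_argmax[OF per[of k]] k by auto
    obtain c d where cd: "c \<in> grid" "d \<in> grid" and mn: "\<And>i j. \<phi> k c d \<le> \<phi> k i j"
    proof -
      have "grid_periodic N (\<lambda>i j. - \<phi> k i j)" using per[of k] k by (simp add: grid_periodic_def)
      from grid_argmax[OF this] show thesis using that by (metis neg_le_iff_le)
    qed
    have "0 \<le> - \<nu> * discrete_laplacian h (\<phi> k) a b
        + on_Dh h (\<phi> k) (\<lambda>q1 q2 q3 q4. K q1 q2 q3 q4 (\<rho> (Suc k) a b)) a b"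
      by (intro hjb_at_max \<nu> \<rho> k mx)
    then have "(\<phi> k a b - \<phi> (Suc k) a b) / dt \<le> A"
      using eq[OF k(1) ab] f[OF k(1) ab] unfolding hjb_residual_def D by linarith
    then have "\<phi> k a b - \<phi> (Suc k) a b \<le> A * dt" using dt by (simp add: pos_divide_le_eq)
    then have u: "\<phi> k a b \<le> A * (1 + real (Suc n) * dt)"
      using nxt[of a b] by (simp add: algebra_simps)
    have "- \<nu> * discrete_laplacian h (\<phi> k) c d
        + on_Dh h (\<phi> k) (\<lambda>q1 q2 q3 q4. K q1 q2 q3 q4 (\<rho> (Suc k) c d)) c d \<le> 0"
      by (intro hjb_at_min h \<nu> \<rho> k mn)
    then have "- A \<le> (\<phi> k c d - \<phi> (Suc k) c d) / dt"
      using eq[OF k(1) cd] f[OF k(1) cd] unfolding hjb_residual_def D by linarith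
    then have "- A * dt \<le> \<phi> k c d - \<phi> (Suc k) c d" using dt by (simp add: pos_le_divide_eq)
    then have l: "- (A * (1 + real (Suc n) * dt)) \<le> \<phi> k c d"
      using nxt[of c d] by (simp add: algebra_simps)
    show ?case
      using u l mx[of i j] mn[of i j] unfolding k_def[symmetric] by linarith
  qed
  from this[of "NT - k" i j] k have "\<bar>\<phi> k i j\<bar> \<le> A * (1 + real (NT - k) * dt)" by simp
  also have "\<dots> \<le> A * (1 + real NT * dt)"
    using A dt by (intro mult_left_mono add_left_mono mult_right_mono) auto
  finally show ?thesis .
qed

section \<open>Existence for couplings that are continuous up to zero density\<close>

lemma exists_solution:
  assumes f: "\<And>k i j. k < NT \<Longrightarrow> i \<in> grid \<Longrightarrow> j \<in> grid \<Longrightarrow>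
      continuous_on {0..} (f (real k * dt) (grid_point h i j))"
    and g: "\<And>i j. i \<in> grid \<Longrightarrow> j \<in> grid \<Longrightarrow> continuous_on {0..} (g (grid_point h i j))"
  shows "\<exists>\<phi> \<rho>. solution f g \<phi> \<rho>"
proof -
  \<comment> \<open>The added 1 keeps the upper face of the density box strictly above anything the
    mass allows.\<close>
  define R where "R = mass + 1"
  have R: "0 < R" using mass_pos by (simp add: R_def)
  have bdd: "\<exists>B. \<forall>r\<in>{0..R}. \<bar>F r\<bar> \<le> B" if "continuous_on {0..} F" for F :: "real \<Rightarrow> real"
  proof -
    have "continuous_on {0..R} F" by (rule continuous_on_subset[OF that]) auto
    from compact_imp_bounded[OF compact_continuous_image[OF this compact_Icc]]
    show ?thesis by (auto simp: bounded_iff)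
  qed
  have "\<exists>B. \<forall>s\<in>{..<NT} \<times> grid \<times> grid. \<forall>r\<in>{0..R}.
      \<bar>case s of (k, i, j) \<Rightarrow> f (real k * dt) (grid_point h i j) r\<bar> \<le> B"
    by (rule finite_uniform_bound) (use bdd[OF f] in auto)
  then obtain A1 where A1: "\<And>k i j r. k < NT \<Longrightarrow> i \<in> grid \<Longrightarrow> j \<in> grid \<Longrightarrow> r \<in> {0..R} \<Longrightarrow>
      \<bar>f (real k * dt) (grid_point h i j) r\<bar> \<le> A1" by fastforce
  have "\<exists>B. \<forall>s\<in>grid \<times> grid. \<forall>r\<in>{0..R}. \<bar>case s of (i, j) \<Rightarrow> g (grid_point h i j) r\<bar> \<le> B"
    by (rule finite_uniform_bound) (use bdd[OF g] in auto)
  then obtain A2 where A2: "\<And>i j r. i \<in> grid \<Longrightarrow> j \<in> grid \<Longrightarrow> r \<in> {0..R} \<Longrightarrow>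
      \<bar>g (grid_point h i j) r\<bar> \<le> A2" by fastforce
  define A where "A = max 0 (max A1 A2)"
  have A: "0 \<le> A" "A1 \<le> A" "A2 \<le> A" by (auto simp: A_def)
  define M where "M k = (A + 1) * (1 + (real NT - real k) * dt)" for k
  have M_step: "M k - M (Suc k) = (A + 1) * dt" for k by (simp add: M_def algebra_simps)
  have M_NT: "M NT = A + 1" by (simp add: M_def)
  have M_pos: "0 < M k" if "k \<le> NT" for k
  proof -
    have "0 \<le> (real NT - real k) * dt" using that dt by simp
    then show ?thesis unfolding M_def using A by (intro mult_pos_pos) auto
  qed

  text \<open>The coordinate \<open>(True, k, i, j)\<close> of the box is \<open>\<rho>\<close> at time \<open>k + 1\<close> and \<open>(False, k, i, j)\<close>
    is \<open>\<phi>\<close> at time \<open>k\<close>. The bound \<open>M k\<close> on \<open>\<phi>\<close> decreases in \<open>k\<close>, so that the HJB residual has a strict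
    sign on the faces of the box.\<close>
  define \<rho> where "\<rho> x k = (case k of 0 \<Rightarrow> \<lambda>i j. cell_average h \<rho>0 (i mod int N) (j mod int N)
      | Suc k \<Rightarrow> \<lambda>i j. x (True, k, i mod int N, j mod int N))"
    for x :: "bool \<times> nat \<times> int \<times> int \<Rightarrow> real" and k
  \<comment> \<open>The terminal condition is built into \<phi>, as the initial one is into \<rho>.
    Reduction modulo \<open>N\<close> makes both periodic for every \<open>x\<close>.\<close>
  define \<phi> where "\<phi> x k i j = (if k = NT then g (grid_point h (i mod int N) (j mod int N)) (\<rho> x NT i j)
      else x (False, k, i mod int N, j mod int N))" for x k i j
  define lo where "lo \<iota> = (case \<iota> of (True, _) \<Rightarrow> 0 | (False, k, _) \<Rightarrow> - M k)"
    for \<iota> :: "bool \<times> nat \<times> int \<times> int"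
  define hi where "hi \<iota> = (case \<iota> of (True, _) \<Rightarrow> R | (False, k, _) \<Rightarrow> M k)"
    for \<iota> :: "bool \<times> nat \<times> int \<times> int"
  define res where "res x \<iota> = (case \<iota> of (True, k, i, j) \<Rightarrow> fp_residual (\<phi> x) (\<rho> x) k i j
      | (False, k, i, j) \<Rightarrow> hjb_residual f (\<phi> x) (\<rho> x) k i j)" for x \<iota>
  define I where "I = (UNIV :: bool set) \<times> {..<NT} \<times> grid \<times> grid"
  define B where "B = {x. \<forall>\<iota>\<in>I. lo \<iota> \<le> x \<iota> \<and> x \<iota> \<le> hi \<iota>}"

  have \<rho>_per: "grid_periodic N (\<rho> x k)" for x k
    by (cases k) (simp_all add: grid_periodic_def \<rho>_def)
  have \<phi>_per: "grid_periodic N (\<phi> x k)" for x k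
    using \<rho>_per[of x NT] by (simp add: grid_periodic_def \<phi>_def)
  have \<rho>_nn: "0 \<le> \<rho> x k i j" if "x \<in> B" "k \<le> NT" for x k i j
  proof (cases k)
    case 0
    then show ?thesis by (simp add: \<rho>_def cell_average_nonneg[OF \<rho>0 h])
  next
    case (Suc l)
    then have "(True, l, i mod int N, j mod int N) \<in> I" using that mod_grid by (auto simp: I_def)
    with that(1) show ?thesis unfolding B_def by (force simp: \<rho>_def lo_def Suc)
  qed
  have \<rho>_le: "\<rho> x (Suc k) i j \<le> R" if "x \<in> B" "k < NT" for x k i j
  proof -
    have "(True, k, i mod int N, j mod int N) \<in> I" using that mod_grid by (auto simp: I_def)
    with that(1) show ?thesis unfolding B_def by (force simp: \<rho>_def hi_def)
  qed
  have \<phi>_bd: "\<bar>\<phi> x k i j\<bar> \<le> M k" if "x \<in> B" "k \<le> NT" for x k i j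
  proof (cases "k = NT")
    case True
    obtain l where l: "NT = Suc l" using NT by (cases NT) auto
    have "\<bar>g (grid_point h (i mod int N) (j mod int N)) (\<rho> x NT i j)\<bar> \<le> A2"
      using \<rho>_nn[OF that(1), of NT i j] \<rho>_le[OF that(1), of l i j] l by (intro A2 mod_grid) auto
    then show ?thesis using True A M_NT by (simp add: \<phi>_def)
  next
    case False
    then have "(False, k, i mod int N, j mod int N) \<in> I" using that mod_grid by (auto simp: I_def)
    with that(1) have "lo (False, k, i mod int N, j mod int N) \<le> x (False, k, i mod int N, j mod int N) \<and>
       x (False, k, i mod int N, j mod int N) \<le> hi (False, k, i mod int N, j mod int N)" unfolding B_def by blast
    then show ?thesis using False by (simp add: \<phi>_def lo_def hi_def abs_le_iff)
  qed

  have \<rho>_cont: "continuous_on B (\<lambda>x. \<rho> x k i j)" for k i j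
    by (cases k) (auto simp: \<rho>_def intro!: continuous_on_subset[OF continuous_on_product_coordinates])
  have \<phi>_cont: "continuous_on B (\<lambda>x. \<phi> x k i j)" if "k \<le> NT" for k i j
  proof (cases "k = NT")
    case True
    have "continuous_on B (\<lambda>x. g (grid_point h (i mod int N) (j mod int N)) (\<rho> x NT i j))"
      by (rule continuous_on_compose2[OF g[OF mod_grid mod_grid] \<rho>_cont]) (use \<rho>_nn in auto)
    then show ?thesis by (simp add: \<phi>_def True)
  next
    case False
    then show ?thesis
      by (auto simp: \<phi>_def intro!: continuous_on_subset[OF continuous_on_product_coordinates])
  qed
  have Dh_cont: "continuous_on B (\<lambda>x. on_Dh h (\<phi> x k) (\<lambda>q1 q2 q3 q4. F q1 q2 q3 q4 (\<rho> x (Suc k) i j)) i j)"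
    if F: "continuous_on {(q1, q2, q3, q4, \<eta>). 0 \<le> \<eta>} (\<lambda>(q1, q2, q3, q4, \<eta>). F q1 q2 q3 q4 \<eta>)"
      and k: "k < NT" for F :: "real \<Rightarrow> real \<Rightarrow> real \<Rightarrow> real \<Rightarrow> real \<Rightarrow> real" and k i j
  proof -
    have D: "continuous_on B (\<lambda>x. D1 h (\<phi> x k) i j)" "continuous_on B (\<lambda>x. D2 h (\<phi> x k) i j)" for i j
      unfolding D1_def D2_def using h k by (auto intro!: continuous_intros \<phi>_cont)
    have c: "continuous_on B (\<lambda>x. (D1 h (\<phi> x k) i j, D1 h (\<phi> x k) (i - 1) j,
          D2 h (\<phi> x k) i j, D2 h (\<phi> x k) i (j - 1), \<rho> x (Suc k) i j))"
      by (intro continuous_on_Pair D \<rho>_cont)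
    have s: "(\<lambda>x. (D1 h (\<phi> x k) i j, D1 h (\<phi> x k) (i - 1) j,
          D2 h (\<phi> x k) i j, D2 h (\<phi> x k) i (j - 1), \<rho> x (Suc k) i j)) ` B
        \<subseteq> {(q1, q2, q3, q4, \<eta>). 0 \<le> \<eta>}"
      using \<rho>_nn k by (simp add: image_subset_iff)
    from continuous_on_compose2[OF F c s] show ?thesis by (simp add: on_Dh_def)
  qed
  have res_cont: "continuous_on B (\<lambda>x. res x \<iota>)" if mem: "\<iota> \<in> I" for \<iota>
  proof -
    obtain b k i j where \<iota>: "\<iota> = (b, k, i, j)" and k: "k < NT" and ij: "i \<in> grid" "j \<in> grid"
      using mem by (cases \<iota>) (auto simp: I_def)
    show ?thesis
    proof (cases b)
      case True
      note slope = continuous_partial(1)[THEN Dh_cont, OF k] continuous_partial(2)[THEN Dh_cont, OF k]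
        continuous_partial(3)[THEN Dh_cont, OF k] continuous_partial(4)[THEN Dh_cont, OF k]
      have "continuous_on B (\<lambda>x. fp_residual (\<phi> x) (\<rho> x) k i j)"
        unfolding fp_residual_def Dt_def discrete_laplacian_def transport_op_def P_eq_slope slope_defs
        using h dt by (intro continuous_intros \<rho>_cont slope) auto
      then show ?thesis by (simp add: res_def \<iota> True)
    next
      case False
      have "continuous_on B (\<lambda>x. f (real k * dt) (grid_point h i j) (\<rho> x (Suc k) i j))"
        by (rule continuous_on_compose2[OF f[OF k ij] \<rho>_cont]) (use \<rho>_nn k in auto)
      then have "continuous_on B (\<lambda>x. hjb_residual f (\<phi> x) (\<rho> x) k i j)"
        unfolding hjb_residual_def Dt_def discrete_laplacian_def
        using h dt k by (intro continuous_intros \<phi>_cont Dh_cont[OF continuous_K]) auto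
      then show ?thesis by (simp add: res_def \<iota> False)
    qed
  qed
  have fin: "finite I" by (simp add: I_def)
  have lohi: "lo \<iota> < hi \<iota>" if "\<iota> \<in> I" for \<iota>
    using that R M_pos by (auto simp: I_def lo_def hi_def split: bool.splits)
  have "\<exists>x. \<forall>\<iota>\<in>I. lo \<iota> \<le> x \<iota> \<and> x \<iota> \<le> hi \<iota> \<and>
      (x \<iota> = lo \<iota> \<or> res x \<iota> \<le> 0) \<and> (x \<iota> = hi \<iota> \<or> 0 \<le> res x \<iota>)"
    by (rule box_variational_inequality) (simp_all add: fin lohi res_cont[unfolded B_def])
  then obtain x where x: "\<forall>\<iota>\<in>I. lo \<iota> \<le> x \<iota> \<and> x \<iota> \<le> hi \<iota> \<and>
      (x \<iota> = lo \<iota> \<or> res x \<iota> \<le> 0) \<and> (x \<iota> = hi \<iota> \<or> 0 \<le> res x \<iota>)" ..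
  have VI: "x \<iota> = lo \<iota> \<or> res x \<iota> \<le> 0" "x \<iota> = hi \<iota> \<or> 0 \<le> res x \<iota>" if "\<iota> \<in> I" for \<iota>
    using x that by simp_all
  have xB: "x \<in> B" using x by (simp add: B_def)

  have hjb: "hjb_residual f (\<phi> x) (\<rho> x) k i j = 0" if k: "k < NT" and ij: "i \<in> grid" "j \<in> grid" for k i j
  proof -
    have \<iota>: "(False, k, i, j) \<in> I" using k ij by (simp add: I_def)
    have xk: "x (False, k, i, j) = \<phi> x k i j" using k ij by (simp add: \<phi>_def)
    have \<rho>k: "0 \<le> \<rho> x (Suc k) i j" "\<rho> x (Suc k) i j \<in> {0..R}"
      using \<rho>_nn[OF xB] \<rho>_le[OF xB k] k by auto
    have fb: "\<bar>f (real k * dt) (grid_point h i j) (\<rho> x (Suc k) i j)\<bar> \<le> A"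
      using A1[OF k ij \<rho>k(2)] A by linarith
    have D: "- Dt dt (\<phi> x) k i j = (\<phi> x k i j - \<phi> x (Suc k) i j) / dt"
      by (simp add: Dt_def minus_divide_left)
    have \<phi>1: "\<bar>\<phi> x (Suc k) i j\<bar> \<le> M (Suc k)" using \<phi>_bd[OF xB, of "Suc k"] k by simp
    have bd: "\<bar>\<phi> x k i' j'\<bar> \<le> M k" for i' j' using \<phi>_bd[OF xB, of k] k by simp
    \<comment> \<open>A positive residual would put \<phi> on the lower face, hence at a minimum
      over the grid. There the spatial part is nonpositive and the time difference is at most
      \<open>- (A + 1)\<close>, which \<open>f\<close> cannot compensate.\<close>
    have "res x (False, k, i, j) \<le> 0"
    proof (rule ccontr)
      assume *: "\<not> res x (False, k, i, j) \<le> 0"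
      then have lo: "\<phi> x k i j = - M k" using VI(1)[OF \<iota>] xk by (simp add: lo_def)
      have "\<phi> x k i j - \<phi> x (Suc k) i j \<le> - ((A + 1) * dt)" using lo M_step[of k] \<phi>1 by linarith
      then have "(\<phi> x k i j - \<phi> x (Suc k) i j) / dt \<le> - (A + 1)"
        unfolding pos_divide_le_eq[OF dt] by (simp only: mult_minus_left)
      moreover have "- \<nu> * discrete_laplacian h (\<phi> x k) i j
          + on_Dh h (\<phi> x k) (\<lambda>q1 q2 q3 q4. K q1 q2 q3 q4 (\<rho> x (Suc k) i j)) i j \<le> 0"
        by (rule hjb_at_min[OF h \<nu> \<rho>k(1)]) (use bd lo in \<open>simp add: abs_le_iff minus_le_iff\<close>)
      ultimately show False using * fb by (simp add: res_def hjb_residual_def D)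
    qed
    moreover have "0 \<le> res x (False, k, i, j)"
    proof (rule ccontr)
      assume *: "\<not> 0 \<le> res x (False, k, i, j)"
      then have hi: "\<phi> x k i j = M k" using VI(2)[OF \<iota>] xk by (simp add: hi_def)
      have "(A + 1) * dt \<le> \<phi> x k i j - \<phi> x (Suc k) i j" using hi M_step[of k] \<phi>1 by linarith
      then have "A + 1 \<le> (\<phi> x k i j - \<phi> x (Suc k) i j) / dt"
        using dt by (simp add: pos_le_divide_eq)
      moreover have "0 \<le> - \<nu> * discrete_laplacian h (\<phi> x k) i j
          + on_Dh h (\<phi> x k) (\<lambda>q1 q2 q3 q4. K q1 q2 q3 q4 (\<rho> x (Suc k) i j)) i j"
        by (rule hjb_at_max[OF \<nu> \<rho>k(1)]) (use bd hi in \<open>simp add: abs_le_iff\<close>)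
      ultimately show False using * fb by (simp add: res_def hjb_residual_def D)
    qed
    ultimately show ?thesis by (simp add: res_def)
  qed

  \<comment> \<open>Off the lower face this is the variational inequality. On it the density is
    zero, and the monotonicity of the scheme gives the sign.\<close>
  have fp_le: "fp_residual (\<phi> x) (\<rho> x) k i j \<le> 0" if k: "k < NT" and ij: "i \<in> grid" "j \<in> grid" for k i j
  proof (cases "x (True, k, i, j) = 0")
    case True
    show ?thesis
    proof (rule fp_residual_nonpos_at_zero)
      show "\<rho> x (Suc k) i j = 0" using True ij by (simp add: \<rho>_def)
    qed (use \<rho>_nn[OF xB] k in auto)
  next
    case False
    have "(True, k, i, j) \<in> I" using k ij by (simp add: I_def)
    from VI(1)[OF this] False show ?thesis by (simp add: lo_def res_def)
  qed
  have mass_le: "gsum N (\<rho> x k) \<le> mass" if "k \<le> NT" for k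
    using that
  proof (induction k)
    case 0
    have "gsum N (\<rho> x 0) = mass" unfolding mass_def by (intro gsum_cong) (simp add: \<rho>_def)
    then show ?case by simp
  next
    case (Suc k)
    have "gsum N (fp_residual (\<phi> x) (\<rho> x) k) \<le> gsum N (\<lambda>i j. 0)"
      by (rule gsum_mono) (use fp_le Suc.prems in auto)
    then have "(gsum N (\<rho> x (Suc k)) - gsum N (\<rho> x k)) / dt \<le> 0"
      using gsum_fp_residual[of "\<phi> x" k "\<rho> x", OF \<phi>_per \<rho>_per] by (simp add: gsum_const)
    then show ?case using Suc dt by (simp add: divide_le_0_iff)
  qed
  \<comment> \<open>No single density exceeds the mass, which is below \<open>R\<close>. So the
    upper face is not attained, and the variational inequality gives the opposite sign.\<close>
  have fp: "fp_residual (\<phi> x) (\<rho> x) k i j = 0" if k: "k < NT" and ij: "i \<in> grid" "j \<in> grid" for k i j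
  proof -
    have "x (True, k, i, j) = \<rho> x (Suc k) i j" using ij by (simp add: \<rho>_def)
    also have "\<dots> \<le> gsum N (\<rho> x (Suc k))"
      by (rule gsum_member_le) (use \<rho>_nn[OF xB] k ij in auto)
    also have "\<dots> < R" using mass_le[of "Suc k"] k by (simp add: R_def)
    finally have "x (True, k, i, j) \<noteq> hi (True, k, i, j)" by (simp add: hi_def)
    moreover have "(True, k, i, j) \<in> I" using k ij by (simp add: I_def)
    ultimately have "0 \<le> fp_residual (\<phi> x) (\<rho> x) k i j" using VI(2) by (force simp: res_def)
    with fp_le[OF k ij] show ?thesis by simp
  qed
  have "solution f g (\<phi> x) (\<rho> x)"
  proof (rule solutionI[where M = "M 0"])
    show "fp_solution (\<phi> x) (\<rho> x)"
      unfolding fp_solution_def using \<phi>_per \<rho>_per \<rho>_nn[OF xB] fp by (auto simp: \<rho>_def)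
    fix k i j assume "k < NT"
    have "M k \<le> M 0" unfolding M_def using A dt by (intro mult_left_mono add_left_mono mult_right_mono) auto
    then show "\<bar>\<phi> x k i j\<bar> \<le> M 0" using \<phi>_bd[OF xB, of k i j] \<open>k < NT\<close> by simp
  qed (use hjb in \<open>auto simp: \<phi>_def\<close>)
  then show ?thesis by blast
qed

end

section \<open>The congestion Hamiltonian\<close>

definition upwind_square :: "real \<Rightarrow> real \<Rightarrow> real \<Rightarrow> real \<Rightarrow> real" where
  "upwind_square q1 q2 q3 q4 = (max (- q1) 0)\<^sup>2 + (max q2 0)\<^sup>2 + (max (- q3) 0)\<^sup>2 + (max q4 0)\<^sup>2"

definition congestion_kernel :: "real \<Rightarrow> real \<Rightarrow> real \<Rightarrow> real \<Rightarrow> real \<Rightarrow> real \<Rightarrow> real \<Rightarrow> real \<Rightarrow> real" where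
  "congestion_kernel \<epsilon> \<alpha> \<beta> q1 q2 q3 q4 \<eta> =
     upwind_square q1 q2 q3 q4 powr (\<beta> / 2) / (\<beta> * (\<eta> + \<epsilon>) powr \<alpha>)"

lemma congestion_hamiltonian_eq: "congestion_hamiltonian \<epsilon> \<alpha> \<beta> = (\<lambda>_ _. congestion_kernel \<epsilon> \<alpha> \<beta>)"
  by (simp add: fun_eq_iff congestion_hamiltonian_def congestion_kernel_def upwind_square_def)

lemma DERIV_max_square: "((\<lambda>q::real. (max q 0)\<^sup>2) has_real_derivative 2 * max q 0) (at q)"
proof (cases "q = 0")
  case True
  have "((\<lambda>y::real. (max y 0)\<^sup>2 / y) \<longlongrightarrow> 0) (at 0)"
  proof (rule Lim_null_comparison)
    show "\<forall>\<^sub>F y::real in at 0. norm ((max y 0)\<^sup>2 / y) \<le> \<bar>y\<bar>"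
      by (intro always_eventually allI) (auto simp: max_def power2_eq_square)
    show "((\<lambda>y::real. \<bar>y\<bar>) \<longlongrightarrow> 0) (at 0)" by (rule tendsto_rabs_zero) (rule tendsto_ident_at)
  qed
  then show ?thesis using True by (simp add: has_field_derivative_iff)
next
  case False
  show ?thesis
  proof (cases "0 < q")
    case True
    have sq: "((\<lambda>q::real. q\<^sup>2) has_real_derivative 2 * max q 0) (at q)"
      using True by (auto intro!: derivative_eq_intros simp: max_def)
    have ev: "\<forall>\<^sub>F y in nhds q. (max y 0)\<^sup>2 = y\<^sup>2"
      using eventually_nhds_in_open[of "{0<..}" q] True by (auto elim!: eventually_mono)
    show ?thesis by (rule iffD2[OF DERIV_cong_ev[OF refl ev refl] sq])
  next
    case F: False
    have "\<forall>\<^sub>F y in nhds q. y \<in> {..<0}"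
      using eventually_nhds_in_open[of "{..<0}" q] False F by simp
    then have ev: "\<forall>\<^sub>F y in nhds q. (max y 0)\<^sup>2 = 0" by (rule eventually_mono) simp
    have z: "2 * max q 0 = 0" using F by simp
    show ?thesis unfolding z by (rule iffD2[OF DERIV_cong_ev[OF refl ev refl] DERIV_const])
  qed
qed

text \<open>Where the base is positive this is the chain rule. Where it vanishes,
  \<open>c = 0\<close> and \<open>q <= 0\<close>; at \<open>q = 0\<close> the difference quotient is
  bounded by \<open>\<bar>y\<bar> powr (\<beta> - 1)\<close>, which tends to 0 because \<beta> >
  1.\<close>

lemma DERIV_max_square_powr:
  assumes c: "0 \<le> c" and b: "1 < \<beta>"
  shows "((\<lambda>q. ((max q 0)\<^sup>2 + c) powr (\<beta> / 2)) has_real_derivative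
    \<beta> * (max q 0 * ((max q 0)\<^sup>2 + c) powr (\<beta> / 2 - 1))) (at q)"
proof (cases "(max q 0)\<^sup>2 + c = 0")
  case False
  then have pos: "0 < (max q 0)\<^sup>2 + c" using c by (simp add: add_nonneg_nonneg less_le)
  have "((\<lambda>q. (max q 0)\<^sup>2 + c) has_real_derivative 2 * max q 0) (at q)"
    using DERIV_add[OF DERIV_max_square DERIV_const] by simp
  from DERIV_fun_powr[OF this pos, of "\<beta> / 2"] show ?thesis by (simp add: mult_ac)
next
  case True
  have sq0: "(max q 0)\<^sup>2 = 0" and c0: "c = 0"
    using True c zero_le_power2[of "max q 0"] by linarith+
  have "max q 0 = 0" using sq0 by (simp only: power_eq_0_iff)
  then have q: "q \<le> 0" using max.cobounded1[of q 0] by linarith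
  show ?thesis
  proof (cases "q = 0")
    case True
    have "((\<lambda>y::real. ((max y 0)\<^sup>2) powr (\<beta> / 2) / y) \<longlongrightarrow> 0) (at 0)"
    proof (rule Lim_null_comparison)
      have "norm (((max y 0)\<^sup>2) powr (\<beta> / 2) / y) \<le> \<bar>y\<bar> powr (\<beta> - 1)" for y :: real
      proof (cases "0 < y")
        case True
        have "(y\<^sup>2) powr (\<beta> / 2) = y powr \<beta>"
          using True powr_powr[of y 2 "\<beta> / 2"] by simp
        then show ?thesis using True by (simp add: powr_diff)
      qed (simp add: max_def)
      then show "\<forall>\<^sub>F y::real in at 0. norm (((max y 0)\<^sup>2) powr (\<beta> / 2) / y) \<le> \<bar>y\<bar> powr (\<beta> - 1)"
        by (intro always_eventually allI)
      have "((\<lambda>y::real. \<bar>y\<bar> powr (\<beta> - 1)) \<longlongrightarrow> \<bar>0\<bar> powr (\<beta> - 1)) (at 0)"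
        using b by (intro tendsto_powr' tendsto_rabs tendsto_ident_at tendsto_const) auto
      then show "((\<lambda>y::real. \<bar>y\<bar> powr (\<beta> - 1)) \<longlongrightarrow> 0) (at 0)" by simp
    qed
    then show ?thesis using True c0 by (simp add: has_field_derivative_iff)
  next
    case False
    with q have "\<forall>\<^sub>F y in nhds q. y \<in> {..<0}"
      using eventually_nhds_in_open[of "{..<0}" q] by simp
    then have ev: "\<forall>\<^sub>F y in nhds q. ((max y 0)\<^sup>2 + c) powr (\<beta> / 2) = 0"
      by (rule eventually_mono) (simp add: c0)
    have z: "\<beta> * (max q 0 * ((max q 0)\<^sup>2 + c) powr (\<beta> / 2 - 1)) = 0" using q by simp
    show ?thesis unfolding z by (rule iffD2[OF DERIV_cong_ev[OF refl ev refl] DERIV_const])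
  qed
qed

text \<open>The exponent may be negative, so the power alone can blow up at zeros of
  \<open>s\<close>. There the bound \<open>\<bar>p\<bar> <= sqrt s\<close> leaves a total exponent
  of \<open>(\<beta> - 1) / 2\<close>, which is positive.\<close>

lemma continuous_on_mult_powr:
  fixes p s :: "'a::topological_space \<Rightarrow> real"
  assumes p: "continuous_on A p" and s: "continuous_on A s"
    and le: "\<And>x. x \<in> A \<Longrightarrow> (p x)\<^sup>2 \<le> s x" and b: "1 < \<beta>"
  shows "continuous_on A (\<lambda>x. p x * s x powr (\<beta> / 2 - 1))"
  unfolding continuous_on_def
proof
  fix x assume x: "x \<in> A"
  have px: "(p \<longlongrightarrow> p x) (at x within A)" and sx: "(s \<longlongrightarrow> s x) (at x within A)"
    using p s x by (auto simp: continuous_on_def)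
  show "((\<lambda>x. p x * s x powr (\<beta> / 2 - 1)) \<longlongrightarrow> p x * s x powr (\<beta> / 2 - 1)) (at x within A)"
  proof (cases "s x = 0")
    case False
    then show ?thesis by (intro tendsto_mult px tendsto_powr sx tendsto_const)
  next
    case True
    have "((\<lambda>x. p x * s x powr (\<beta> / 2 - 1)) \<longlongrightarrow> 0) (at x within A)"
    proof (rule Lim_null_comparison)
      have "norm (p y * s y powr (\<beta> / 2 - 1)) \<le> s y powr ((\<beta> - 1) / 2)" if "y \<in> A" for y
      proof (cases "s y = 0")
        case False
        have sy: "0 < s y" using le[OF that] False by (metis zero_le_power2 order_trans less_le)
        have "\<bar>p y\<bar> \<le> sqrt (s y)" using le[OF that] real_le_rsqrt[of "\<bar>p y\<bar>"] by simp
        then have "\<bar>p y\<bar> * s y powr (\<beta> / 2 - 1) \<le> s y powr (1 / 2) * s y powr (\<beta> / 2 - 1)"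
          using sy by (intro mult_right_mono) (simp_all add: powr_half_sqrt)
        also have "\<dots> = s y powr ((\<beta> - 1) / 2)" by (simp flip: powr_add add: field_simps)
        finally show ?thesis by (simp add: abs_mult)
      qed simp
      then show "\<forall>\<^sub>F y in at x within A. norm (p y * s y powr (\<beta> / 2 - 1)) \<le> s y powr ((\<beta> - 1) / 2)"
        by (auto simp: eventually_at_filter)
      have "0 \<le> s y" if "y \<in> A" for y using le[OF that] by (meson order_trans zero_le_power2)
      then have "\<forall>\<^sub>F y in at x within A. 0 \<le> s y" by (auto simp: eventually_at_filter)
      then have "((\<lambda>y. s y powr ((\<beta> - 1) / 2)) \<longlongrightarrow> s x powr ((\<beta> - 1) / 2)) (at x within A)"
        using b True by (intro tendsto_powr' sx tendsto_const) auto
      then show "((\<lambda>y. s y powr ((\<beta> - 1) / 2)) \<longlongrightarrow> 0) (at x within A)" using True by simp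
    qed
    then show ?thesis using True by simp
  qed
qed

context
  fixes \<epsilon> \<alpha> \<beta> :: real
  assumes \<epsilon>: "0 < \<epsilon>" and \<beta>: "1 < \<beta>"
begin

text \<open>The common factor of the four partial derivatives. At zero base \<open>powr\<close>
  yields 0 even for a negative exponent; this is harmless since the factor multiplied with it in the
  partial derivatives vanishes there too.\<close>

definition congestion_weight where
  "congestion_weight q1 q2 q3 q4 \<eta> = upwind_square q1 q2 q3 q4 powr (\<beta> / 2 - 1) / (\<eta> + \<epsilon>) powr \<alpha>"

text \<open>In each variable the other three squares form a nonnegative constant \<open>c\<close>,
  which reduces everything to \<open>DERIV_max_square_powr\<close>.\<close>

lemma partial_congestion:
  "partial1 (congestion_kernel \<epsilon> \<alpha> \<beta>) q1 q2 q3 q4 \<eta> = - (max (- q1) 0 * congestion_weight q1 q2 q3 q4 \<eta>)"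
  "partial2 (congestion_kernel \<epsilon> \<alpha> \<beta>) q1 q2 q3 q4 \<eta> = max q2 0 * congestion_weight q1 q2 q3 q4 \<eta>"
  "partial3 (congestion_kernel \<epsilon> \<alpha> \<beta>) q1 q2 q3 q4 \<eta> = - (max (- q3) 0 * congestion_weight q1 q2 q3 q4 \<eta>)"
  "partial4 (congestion_kernel \<epsilon> \<alpha> \<beta>) q1 q2 q3 q4 \<eta> = max q4 0 * congestion_weight q1 q2 q3 q4 \<eta>"
proof -
  let ?e = "(\<eta> + \<epsilon>) powr \<alpha>"
  have pos: "((\<lambda>q. ((max q 0)\<^sup>2 + c) powr (\<beta> / 2) / (\<beta> * ?e)) has_real_derivative
      max q 0 * (((max q 0)\<^sup>2 + c) powr (\<beta> / 2 - 1) / ?e)) (at q)" if "0 \<le> c" for q c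
    using DERIV_cdivide[OF DERIV_max_square_powr[OF that \<beta>], of "\<beta> * ?e"] \<beta> by simp
  have neg: "((\<lambda>q. ((max (- q) 0)\<^sup>2 + c) powr (\<beta> / 2) / (\<beta> * ?e)) has_real_derivative
      - (max (- q) 0 * (((max (- q) 0)\<^sup>2 + c) powr (\<beta> / 2 - 1) / ?e))) (at q)" if "0 \<le> c" for q c
    using DERIV_chain2[OF pos[OF that, of "- q"] DERIV_minus[OF DERIV_ident]] by simp
  show "partial1 (congestion_kernel \<epsilon> \<alpha> \<beta>) q1 q2 q3 q4 \<eta> = - (max (- q1) 0 * congestion_weight q1 q2 q3 q4 \<eta>)"
    unfolding partial1_def congestion_kernel_def congestion_weight_def upwind_square_def
    using DERIV_imp_deriv[OF neg[of "(max q2 0)\<^sup>2 + (max (- q3) 0)\<^sup>2 + (max q4 0)\<^sup>2" q1]]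
    by (simp add: add_ac)
  show "partial2 (congestion_kernel \<epsilon> \<alpha> \<beta>) q1 q2 q3 q4 \<eta> = max q2 0 * congestion_weight q1 q2 q3 q4 \<eta>"
    unfolding partial2_def congestion_kernel_def congestion_weight_def upwind_square_def
    using DERIV_imp_deriv[OF pos[of "(max (- q1) 0)\<^sup>2 + (max (- q3) 0)\<^sup>2 + (max q4 0)\<^sup>2" q2]]
    by (simp add: add_ac)
  show "partial3 (congestion_kernel \<epsilon> \<alpha> \<beta>) q1 q2 q3 q4 \<eta> = - (max (- q3) 0 * congestion_weight q1 q2 q3 q4 \<eta>)"
    unfolding partial3_def congestion_kernel_def congestion_weight_def upwind_square_def
    using DERIV_imp_deriv[OF neg[of "(max (- q1) 0)\<^sup>2 + (max q2 0)\<^sup>2 + (max q4 0)\<^sup>2" q3]]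
    by (simp add: add_ac)
  show "partial4 (congestion_kernel \<epsilon> \<alpha> \<beta>) q1 q2 q3 q4 \<eta> = max q4 0 * congestion_weight q1 q2 q3 q4 \<eta>"
    unfolding partial4_def congestion_kernel_def congestion_weight_def upwind_square_def
    using DERIV_imp_deriv[OF pos[of "(max (- q1) 0)\<^sup>2 + (max q2 0)\<^sup>2 + (max (- q3) 0)\<^sup>2" q4]]
    by (simp add: add_ac)
qed

lemma hjb_congestion: "hjb_hamiltonian (congestion_kernel \<epsilon> \<alpha> \<beta>)"
proof
  note w = partial_congestion
  have sq: "0 \<le> upwind_square q1 q2 q3 q4" for q1 q2 q3 q4 by (simp add: upwind_square_def)
  have wn: "0 \<le> congestion_weight q1 q2 q3 q4 \<eta>" for q1 q2 q3 q4 \<eta> by (simp add: congestion_weight_def)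
  show "0 \<le> congestion_kernel \<epsilon> \<alpha> \<beta> q1 q2 q3 q4 \<eta>" for q1 q2 q3 q4 \<eta>
    using \<beta> by (simp add: congestion_kernel_def)
  show "congestion_kernel \<epsilon> \<alpha> \<beta> q1 q2 q3 q4 \<eta> = 0" if "0 \<le> q1" "q2 \<le> 0" "0 \<le> q3" "q4 \<le> 0" for q1 q2 q3 q4 \<eta>
    using that by (simp add: congestion_kernel_def upwind_square_def max_def)
  show "partial1 (congestion_kernel \<epsilon> \<alpha> \<beta>) q1 q2 q3 q4 \<eta> \<le> 0" "0 \<le> partial2 (congestion_kernel \<epsilon> \<alpha> \<beta>) q1 q2 q3 q4 \<eta>"
    "partial3 (congestion_kernel \<epsilon> \<alpha> \<beta>) q1 q2 q3 q4 \<eta> \<le> 0" "0 \<le> partial4 (congestion_kernel \<epsilon> \<alpha> \<beta>) q1 q2 q3 q4 \<eta>"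
    for q1 q2 q3 q4 \<eta>
    by (simp_all add: w wn)
  \<comment> \<open>Euler's relation: the kernel is positively homogeneous of degree \<beta> in
    \<open>q\<close>, so the right-hand side is \<beta> times the kernel, and \<beta> > 1.\<close>
  show "congestion_kernel \<epsilon> \<alpha> \<beta> q1 q2 q3 q4 \<eta> \<le> q1 * partial1 (congestion_kernel \<epsilon> \<alpha> \<beta>) q1 q2 q3 q4 \<eta>
      + q2 * partial2 (congestion_kernel \<epsilon> \<alpha> \<beta>) q1 q2 q3 q4 \<eta> + q3 * partial3 (congestion_kernel \<epsilon> \<alpha> \<beta>) q1 q2 q3 q4 \<eta>
      + q4 * partial4 (congestion_kernel \<epsilon> \<alpha> \<beta>) q1 q2 q3 q4 \<eta>" for q1 q2 q3 q4 \<eta>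
  proof -
    let ?s = "upwind_square q1 q2 q3 q4"
    have "q1 * - max (- q1) 0 = (max (- q1) 0)\<^sup>2" "q2 * max q2 0 = (max q2 0)\<^sup>2"
      "q3 * - max (- q3) 0 = (max (- q3) 0)\<^sup>2" "q4 * max q4 0 = (max q4 0)\<^sup>2"
      by (auto simp: max_def power2_eq_square)
    then have "?s * congestion_weight q1 q2 q3 q4 \<eta> = (q1 * - max (- q1) 0 + q2 * max q2 0 + q3 * - max (- q3) 0 + q4 * max q4 0)
        * congestion_weight q1 q2 q3 q4 \<eta>"
      by (simp add: upwind_square_def)
    moreover have "?s * congestion_weight q1 q2 q3 q4 \<eta> = ?s powr (\<beta> / 2) / (\<eta> + \<epsilon>) powr \<alpha>"
    proof (cases "?s = 0")
      case False
      then have "0 < ?s" using sq less_le by metis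
      then have "?s * ?s powr (\<beta> / 2 - 1) = ?s powr (\<beta> / 2)" by (simp add: powr_diff)
      then show ?thesis by (simp add: congestion_weight_def)
    qed simp
    moreover have "congestion_kernel \<epsilon> \<alpha> \<beta> q1 q2 q3 q4 \<eta> \<le> ?s powr (\<beta> / 2) / (\<eta> + \<epsilon>) powr \<alpha>"
    proof -
      have "?s powr (\<beta> / 2) / (\<eta> + \<epsilon>) powr \<alpha> / \<beta> \<le> ?s powr (\<beta> / 2) / (\<eta> + \<epsilon>) powr \<alpha>"
        using divide_left_mono[of 1 \<beta> "?s powr (\<beta> / 2) / (\<eta> + \<epsilon>) powr \<alpha>"] \<beta> by simp
      then show ?thesis by (simp add: congestion_kernel_def mult.commute)
    qed
    ultimately show ?thesis by (simp add: w algebra_simps)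
  qed
  let ?A = "{p. 0 \<le> snd (snd (snd (snd p)))} :: (real \<times> real \<times> real \<times> real \<times> real) set"
  \<comment> \<open>The shift by \<epsilon> keeps the denominator positive up to zero
    density.\<close>
  have e: "continuous_on ?A (\<lambda>x. (snd (snd (snd (snd x))) + \<epsilon>) powr \<alpha>)"
    using \<epsilon> by (intro continuous_intros) auto
  have en: "(snd (snd (snd (snd x))) + \<epsilon>) powr \<alpha> \<noteq> 0" if "x \<in> ?A" for x using that \<epsilon> by auto
  have s: "continuous_on ?A (\<lambda>x. upwind_square (fst x) (fst (snd x)) (fst (snd (snd x))) (fst (snd (snd (snd x)))))"
    unfolding upwind_square_def by (intro continuous_intros)
  have sp: "continuous_on ?A (\<lambda>x. upwind_square (fst x) (fst (snd x)) (fst (snd (snd x))) (fst (snd (snd (snd x)))) powr (\<beta> / 2))"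
    using \<beta> sq by (intro continuous_on_powr' s continuous_on_const) auto
  show "continuous_on {(q1, q2, q3, q4, \<eta>). 0 \<le> \<eta>} (\<lambda>(q1, q2, q3, q4, \<eta>). congestion_kernel \<epsilon> \<alpha> \<beta> q1 q2 q3 q4 \<eta>)"
    unfolding congestion_kernel_def case_prod_beta
    using en \<beta> by (intro continuous_on_divide sp continuous_on_mult e continuous_on_const) auto
  have main: "continuous_on ?A (\<lambda>x. p x * congestion_weight (fst x) (fst (snd x)) (fst (snd (snd x))) (fst (snd (snd (snd x)))) (snd (snd (snd (snd x)))))"
    if "continuous_on ?A p"
      "\<And>x. (p x)\<^sup>2 \<le> upwind_square (fst x) (fst (snd x)) (fst (snd (snd x))) (fst (snd (snd (snd x))))" for p
    unfolding congestion_weight_def times_divide_eq_right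
    using en by (intro continuous_on_divide continuous_on_mult_powr s \<beta> that e) auto
  show "continuous_on {(q1, q2, q3, q4, \<eta>). 0 \<le> \<eta>} (\<lambda>(q1, q2, q3, q4, \<eta>). partial1 (congestion_kernel \<epsilon> \<alpha> \<beta>) q1 q2 q3 q4 \<eta>)"
    unfolding w case_prod_beta
    by (intro continuous_on_minus main continuous_intros) (simp add: upwind_square_def)
  show "continuous_on {(q1, q2, q3, q4, \<eta>). 0 \<le> \<eta>} (\<lambda>(q1, q2, q3, q4, \<eta>). partial2 (congestion_kernel \<epsilon> \<alpha> \<beta>) q1 q2 q3 q4 \<eta>)"
    unfolding w case_prod_beta
    by (intro main continuous_intros) (simp add: upwind_square_def)
  show "continuous_on {(q1, q2, q3, q4, \<eta>). 0 \<le> \<eta>} (\<lambda>(q1, q2, q3, q4, \<eta>). partial3 (congestion_kernel \<epsilon> \<alpha> \<beta>) q1 q2 q3 q4 \<eta>)"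
    unfolding w case_prod_beta
    by (intro continuous_on_minus main continuous_intros) (simp add: upwind_square_def)
  show "continuous_on {(q1, q2, q3, q4, \<eta>). 0 \<le> \<eta>} (\<lambda>(q1, q2, q3, q4, \<eta>). partial4 (congestion_kernel \<epsilon> \<alpha> \<beta>) q1 q2 q3 q4 \<eta>)"
    unfolding w case_prod_beta
    by (intro main continuous_intros) (simp add: upwind_square_def)
qed

end

text \<open>With this kernel the density equation becomes the implicit discrete heat
  equation.\<close>

lemma hjb_zero: "hjb_hamiltonian (\<lambda>_ _ _ _ _. 0)"
  by standard (simp_all add: partial1_def partial2_def partial3_def partial4_def case_prod_beta)

section \<open>Monotone couplings\<close>

lemma discrete_laplacian_diff:
  "discrete_laplacian h (\<lambda>i j. u i j - v i j) i j = discrete_laplacian h u i j - discrete_laplacian h v i j"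
  by (simp add: discrete_laplacian_def diff_divide_distrib[symmetric] algebra_simps)

text \<open>Here \<open>r\<close> stands for the density, \<open>s\<close> for the heat flow and
  \<open>m\<close> for the mass. As \<delta> is below \<open>s\<close>, truncation does not disturb
  the order of \<open>r\<close> and \<open>s\<close>, so monotonicity bounds the product below by
  \<open>F s * (r - s)\<close>. Conversely, an upper bound on the product bounds \<open>F\<close>
  itself from below: either \<open>r\<close> is at least \<open>r0\<close>, or the gap
  \<open>s - r\<close> is at least \<open>r0\<close>.\<close>

lemma truncation_bounds:
  fixes F :: "real \<Rightarrow> real"
  assumes mono: "mono_on {0<..} F" and \<delta>: "0 < \<delta>" "\<delta> \<le> r0" and s: "2 * r0 \<le> s" "s \<le> m"
    and r: "0 \<le> r" "r \<le> m" and B: "\<bar>F s\<bar> \<le> B"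
  shows "- (B * m) \<le> F (max r \<delta>) * (r - s)"
    and "F (max r \<delta>) * (r - s) \<le> Z \<Longrightarrow> 0 \<le> Z \<Longrightarrow> \<bar>F m\<bar> \<le> C \<Longrightarrow> \<bar>F r0\<bar> \<le> C \<Longrightarrow> \<bar>F (max r \<delta>)\<bar> \<le> C + Z / r0"
proof -
  have mn: "F a \<le> F b" if "0 < a" "a \<le> b" for a b using monotone_onD[OF mono, of a b] that by simp
  have "0 \<le> (F (max r \<delta>) - F s) * (r - s)"
  proof (cases "s \<le> r")
    case True
    then show ?thesis using mn[of s "max r \<delta>"] s \<delta> by (intro mult_nonneg_nonneg) auto
  next
    case False
    then show ?thesis using mn[of "max r \<delta>" s] s \<delta> by (intro mult_nonpos_nonpos) auto
  qed
  moreover have "\<bar>F s * (r - s)\<bar> \<le> B * m"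
    unfolding abs_mult using B r s \<delta> by (intro mult_mono) auto
  ultimately show "- (B * m) \<le> F (max r \<delta>) * (r - s)" by (simp add: algebra_simps abs_le_iff)
  assume Z: "F (max r \<delta>) * (r - s) \<le> Z" "0 \<le> Z" and C: "\<bar>F m\<bar> \<le> C" "\<bar>F r0\<bar> \<le> C"
  have Zr: "0 \<le> Z / r0" using Z \<delta> by simp
  have "F (max r \<delta>) \<le> F m" using s r \<delta> by (intro mn) auto
  moreover have "- (C + Z / r0) \<le> F (max r \<delta>)"
  proof (cases "r0 \<le> r")
    case True
    then have "F r0 \<le> F (max r \<delta>)" using \<delta> by (intro mn) auto
    then show ?thesis using C Zr by linarith
  next
    case False
    show ?thesis
    proof (cases "0 \<le> F (max r \<delta>)")
      case True
      then show ?thesis using C Zr by linarith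
    next
      case neg: False
      \<comment> \<open>Since \<open>s\<close> is at least \<open>2 * r0\<close> and
        \<open>r\<close> is below \<open>r0\<close>, a very negative value of \<open>F\<close> would
        make the product exceed \<open>Z\<close>.\<close>
      have "- F (max r \<delta>) * r0 \<le> - F (max r \<delta>) * (s - r)"
        using neg False s by (intro mult_left_mono) auto
      also have "\<dots> \<le> Z" using Z by (simp add: algebra_simps)
      finally have "- F (max r \<delta>) \<le> Z / r0" using \<delta> by (simp add: pos_le_divide_eq)
      then show ?thesis using C by linarith
    qed
  qed
  ultimately show "\<bar>F (max r \<delta>)\<bar> \<le> C + Z / r0" using C Zr by linarith
qed

section \<open>Energy estimate against the heat flow and removal of the truncation\<close>

context discrete_mfg begin

text \<open>The Lasry-Lions duality argument with \<sigma>, which moves by diffusion alone, as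
  competitor. The equation for \<phi> is tested with \<open>w\<close>, the difference of the
  densities, and the equation for \<open>w\<close> with \<phi>. The Laplacians cancel by symmetry
  and the time differences telescope, starting from \<open>E 0 = 0\<close> as both densities have
  the same initial values.\<close>

lemma energy_inequality:
  assumes sol: "solution f g \<phi> \<rho>"
    and \<sigma>: "\<And>k. k \<le> NT \<Longrightarrow> grid_periodic N (\<sigma> k)" "\<And>k i j. k \<le> NT \<Longrightarrow> 0 \<le> \<sigma> k i j"
      "\<And>i j. i \<in> grid \<Longrightarrow> j \<in> grid \<Longrightarrow> \<sigma> 0 i j = \<rho> 0 i j"
      "\<And>k i j. k < NT \<Longrightarrow> i \<in> grid \<Longrightarrow> j \<in> grid \<Longrightarrow> Dt dt \<sigma> k i j = \<nu> * discrete_laplacian h (\<sigma> (Suc k)) i j"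
  shows "dt * (\<Sum>k<NT. gsum N (\<lambda>i j. f (real k * dt) (grid_point h i j) (\<rho> (Suc k) i j) * (\<rho> (Suc k) i j - \<sigma> (Suc k) i j)))
    + gsum N (\<lambda>i j. g (grid_point h i j) (\<rho> NT i j) * (\<rho> NT i j - \<sigma> NT i j)) \<le> 0"
proof -
  define w where "w k i j = \<rho> k i j - \<sigma> k i j" for k i j
  define E where "E k = gsum N (\<lambda>i j. \<phi> k i j * w k i j)" for k
  have per: "grid_periodic N (\<phi> k)" "grid_periodic N (\<rho> k)" "grid_periodic N (w k)" if "k \<le> NT" for k
    using solution_periodic[OF sol that] \<sigma>(1)[OF that] by (auto simp: w_def grid_periodic_def)
  have step: "dt * gsum N (\<lambda>i j. f (real k * dt) (grid_point h i j) (\<rho> (Suc k) i j) * w (Suc k) i j)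
      \<le> E k - E (Suc k)" if k: "k < NT" for k
  proof -
    let ?f = "\<lambda>i j. f (real k * dt) (grid_point h i j) (\<rho> (Suc k) i j)"
    let ?K = "\<lambda>i j. on_Dh h (\<phi> k) (\<lambda>q1 q2 q3 q4. K q1 q2 q3 q4 (\<rho> (Suc k) i j)) i j"
    let ?T = "transport_op (\<lambda>_ _. K) h (real k * dt) (\<phi> k) (\<rho> (Suc k)) (\<rho> (Suc k))"
    let ?e = "\<lambda>i j. D1 h (\<phi> k) i j * slope1 K h (\<phi> k) (\<rho> (Suc k)) i j
        + D1 h (\<phi> k) (i - 1) j * slope2 K h (\<phi> k) (\<rho> (Suc k)) i j
        + D2 h (\<phi> k) i j * slope3 K h (\<phi> k) (\<rho> (Suc k)) i j
        + D2 h (\<phi> k) i (j - 1) * slope4 K h (\<phi> k) (\<rho> (Suc k)) i j"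
    note p = per[of k] per[of "Suc k"]
    have nn: "0 \<le> \<rho> (Suc k) i j" "0 \<le> \<sigma> (Suc k) i j" for i j
      using solution_pos[OF sol k, of i j] \<sigma>(2)[of "Suc k" i j] k by auto
    have "gsum N (\<lambda>i j. ?f i j * w (Suc k) i j)
      = gsum N (\<lambda>i j. - Dt dt \<phi> k i j * w (Suc k) i j
          - \<nu> * (discrete_laplacian h (\<phi> k) i j * w (Suc k) i j) + ?K i j * w (Suc k) i j)"
    proof (rule gsum_cong)
      fix i j assume "i \<in> grid" "j \<in> grid"
      from solution_hjb[OF sol k this]
      have "?f i j = - Dt dt \<phi> k i j - \<nu> * discrete_laplacian h (\<phi> k) i j + ?K i j"
        by (simp add: hjb_residual_def)
      then show "?f i j * w (Suc k) i j = - Dt dt \<phi> k i j * w (Suc k) i j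
          - \<nu> * (discrete_laplacian h (\<phi> k) i j * w (Suc k) i j) + ?K i j * w (Suc k) i j"
        by (simp only: ring_distribs mult.assoc)
    qed
    also have "\<dots> = gsum N (\<lambda>i j. - Dt dt \<phi> k i j * w (Suc k) i j)
        - \<nu> * gsum N (\<lambda>i j. \<phi> k i j * discrete_laplacian h (w (Suc k)) i j) + gsum N (\<lambda>i j. ?K i j * w (Suc k) i j)"
      using gsum_laplacian_symmetric[of N "\<phi> k" "w (Suc k)" h] p k by (simp add: gsum_add gsum_diff gsum_scale)
    also have "\<dots> = gsum N (\<lambda>i j. - Dt dt \<phi> k i j * w (Suc k) i j - \<phi> k i j * (\<nu> * discrete_laplacian h (w (Suc k)) i j))
        + gsum N (\<lambda>i j. ?K i j * w (Suc k) i j)"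
      by (simp add: gsum_diff mult.left_commute[of "\<phi> k _ _" \<nu>] gsum_scale)
    \<comment> \<open>Summation by parts in time: \<phi> at step \<open>k\<close> is paired with the
      increment of \<open>w\<close>, and \<open>w\<close> at step \<open>k + 1\<close> with the
      increment of \<phi>, so the products form an exact difference.\<close>
    also have "gsum N (\<lambda>i j. - Dt dt \<phi> k i j * w (Suc k) i j - \<phi> k i j * (\<nu> * discrete_laplacian h (w (Suc k)) i j))
      = gsum N (\<lambda>i j. (\<phi> k i j * w k i j - \<phi> (Suc k) i j * w (Suc k) i j) / dt + \<phi> k i j * ?T i j)"
    proof (rule gsum_cong)
      fix i j assume ij: "i \<in> grid" "j \<in> grid"
      have "fp_residual \<phi> \<rho> k i j = 0"
        using solution_fp[OF sol] k ij by (simp add: fp_solution_def)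
      then have e: "\<nu> * discrete_laplacian h (w (Suc k)) i j = Dt dt \<rho> k i j - Dt dt \<sigma> k i j - ?T i j"
        unfolding w_def discrete_laplacian_diff fp_residual_def using \<sigma>(4)[OF k ij] by (simp add: right_diff_distrib)
      show "- Dt dt \<phi> k i j * w (Suc k) i j - \<phi> k i j * (\<nu> * discrete_laplacian h (w (Suc k)) i j)
        = (\<phi> k i j * w k i j - \<phi> (Suc k) i j * w (Suc k) i j) / dt + \<phi> k i j * ?T i j"
        unfolding e w_def Dt_def divide_inverse by algebra
    qed
    also have "\<dots> = (E k - E (Suc k)) / dt - gsum N (\<lambda>i j. \<rho> (Suc k) i j * ?e i j)"
      using gsum_transport_by_parts[OF p(1,5,5,1)] k by (simp add: gsum_add gsum_divide gsum_diff E_def)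
    finally have "gsum N (\<lambda>i j. ?f i j * w (Suc k) i j) = (E k - E (Suc k)) / dt
        + gsum N (\<lambda>i j. ?K i j * w (Suc k) i j - \<rho> (Suc k) i j * ?e i j)"
      by (simp add: gsum_diff)
    \<comment> \<open>The part with \<rho> is nonpositive because the running cost is nonnegative,
      the part with \<sigma> because \<open>K\<close> is.\<close>
    moreover have "gsum N (\<lambda>i j. ?K i j * w (Suc k) i j - \<rho> (Suc k) i j * ?e i j) \<le> gsum N (\<lambda>i j. 0)"
    proof (rule gsum_mono)
      fix i j
      have "?K i j \<le> ?e i j" using K_le_euler[OF nn(1)] by (simp add: on_Dh_def slope_defs)
      then have "\<rho> (Suc k) i j * ?K i j \<le> \<rho> (Suc k) i j * ?e i j" using nn by (intro mult_left_mono)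
      moreover have "0 \<le> ?K i j * \<sigma> (Suc k) i j"
        using K_nonneg[OF nn(1)] nn(2) by (simp add: on_Dh_def)
      ultimately show "?K i j * w (Suc k) i j - \<rho> (Suc k) i j * ?e i j \<le> 0"
        by (simp only: w_def right_diff_distrib mult.commute[of "?K i j" "\<rho> (Suc k) i j"])
    qed
    ultimately have "gsum N (\<lambda>i j. ?f i j * w (Suc k) i j) \<le> (E k - E (Suc k)) / dt"
      by (simp add: gsum_const)
    then show ?thesis using dt by (simp add: pos_le_divide_eq mult.commute)
  qed
  have "dt * (\<Sum>k<NT. gsum N (\<lambda>i j. f (real k * dt) (grid_point h i j) (\<rho> (Suc k) i j) * w (Suc k) i j))
      \<le> (\<Sum>k<NT. E k - E (Suc k))"
    unfolding sum_distrib_left by (rule sum_mono) (use step in simp)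
  also have "\<dots> = E 0 - E NT" by (rule sum_lessThan_telescope')
  also have "E 0 = gsum N (\<lambda>i j. 0)"
    unfolding E_def w_def by (rule gsum_cong) (simp add: \<sigma>(3))
  also have "E NT = gsum N (\<lambda>i j. g (grid_point h i j) (\<rho> NT i j) * w NT i j)"
    unfolding E_def by (rule gsum_cong) (simp add: solution_terminal[OF sol])
  finally show ?thesis by (simp add: w_def gsum_const)
qed

text \<open>Zero kernel and zero couplings are an instance of the existence result just proved.
  Positivity is part of being a solution, and the minimum over finitely many times and points gives
  \<open>c\<close>.\<close>

lemma exists_heat_flow:
  obtains \<sigma> c where "0 < c" "\<And>k. k \<le> NT \<Longrightarrow> grid_periodic N (\<sigma> k)" "\<And>k i j. k \<le> NT \<Longrightarrow> 0 \<le> \<sigma> k i j"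
    "\<And>k i j. k \<le> NT \<Longrightarrow> \<sigma> k i j \<le> mass"
    "\<And>i j. \<sigma> 0 i j = cell_average h \<rho>0 (i mod int N) (j mod int N)"
    "\<And>k i j. k < NT \<Longrightarrow> i \<in> grid \<Longrightarrow> j \<in> grid \<Longrightarrow> Dt dt \<sigma> k i j = \<nu> * discrete_laplacian h (\<sigma> (Suc k)) i j"
    "\<And>k i j. k < NT \<Longrightarrow> i \<in> grid \<Longrightarrow> j \<in> grid \<Longrightarrow> c \<le> \<sigma> (Suc k) i j"
proof -
  interpret heat: discrete_mfg "\<lambda>_ _ _ _ _. 0" N NT h dt \<nu> \<rho>0
    by (intro discrete_mfg.intro hjb_zero discrete_mfg_axioms.intro h dt \<nu> Nh NT \<rho>0)
  obtain \<psi> \<sigma> where sol: "heat.solution (\<lambda>_ _ _. 0) (\<lambda>_ _. 0) \<psi> \<sigma>"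
    using heat.exists_solution[of "\<lambda>_ _ _. 0" "\<lambda>_ _. 0"] by auto
  let ?S = "(\<lambda>(k, i, j). \<sigma> (Suc k) i j) ` ({..<NT} \<times> grid \<times> grid)"
  have S: "finite ?S" "?S \<noteq> {}" using NT N_pos by auto
  show thesis
  proof (rule that)
    show "0 < Min ?S" using S heat.solution_pos[OF sol] by (subst Min_gr_iff) auto
    show "grid_periodic N (\<sigma> k)" if "k \<le> NT" for k using heat.solution_periodic[OF sol that] by simp
    show "0 \<le> \<sigma> k i j" if "k \<le> NT" for k i j
      using heat.solution_fp[OF sol] that by (simp add: heat.fp_solution_def)
    show "\<sigma> k i j \<le> mass" if "k \<le> NT" for k i j
      by (rule heat.fp_solution_le_mass[OF heat.solution_fp[OF sol] that])
    show "\<sigma> 0 i j = cell_average h \<rho>0 (i mod int N) (j mod int N)" for i j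
      by (rule heat.solution_initial[OF sol])
    show "Dt dt \<sigma> k i j = \<nu> * discrete_laplacian h (\<sigma> (Suc k)) i j" if "k < NT" "i \<in> grid" "j \<in> grid" for k i j
    proof -
      have "heat.fp_residual \<psi> \<sigma> k i j = 0"
        using heat.solution_fp[OF sol] that by (simp add: heat.fp_solution_def)
      then show ?thesis
        by (simp add: heat.fp_residual_def transport_expand slope_defs on_Dh_def
            partial1_def partial2_def partial3_def partial4_def)
    qed
    show "Min ?S \<le> \<sigma> (Suc k) i j" if "k < NT" "i \<in> grid" "j \<in> grid" for k i j
      using S(1) that by (intro Min_le) force+
  qed
qed

text \<open>The order of the constants is decisive: the bound \<open>A\<close> on the couplings does
  not depend on \<delta>, it determines \<open>M\<close> and the lower density bound
  \<open>c\<close>, and only then is \<delta> chosen.\<close>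

lemma exists_solution_monotone:
  assumes fm: "\<And>k i j. k < NT \<Longrightarrow> mono_on {0<..} (f (real k * dt) (grid_point h i j))"
    and fc: "\<And>k i j. k < NT \<Longrightarrow> continuous_on {0<..} (f (real k * dt) (grid_point h i j))"
    and gm: "\<And>i j. mono_on {0<..} (g (grid_point h i j))"
    and gc: "\<And>i j. continuous_on {0<..} (g (grid_point h i j))"
  shows "\<exists>\<phi> \<rho>. solution f g \<phi> \<rho>"
proof -
  obtain \<sigma> c0 where c0: "0 < c0" and \<sigma>: "\<And>k. k \<le> NT \<Longrightarrow> grid_periodic N (\<sigma> k)" "\<And>k i j. k \<le> NT \<Longrightarrow> 0 \<le> \<sigma> k i j"
    "\<And>k i j. k \<le> NT \<Longrightarrow> \<sigma> k i j \<le> mass"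
    "\<And>i j. \<sigma> 0 i j = cell_average h \<rho>0 (i mod int N) (j mod int N)"
    "\<And>k i j. k < NT \<Longrightarrow> i \<in> grid \<Longrightarrow> j \<in> grid \<Longrightarrow> Dt dt \<sigma> k i j = \<nu> * discrete_laplacian h (\<sigma> (Suc k)) i j"
    "\<And>k i j. k < NT \<Longrightarrow> i \<in> grid \<Longrightarrow> j \<in> grid \<Longrightarrow> c0 \<le> \<sigma> (Suc k) i j"
    by (rule exists_heat_flow) blast
  \<comment> \<open>Half the lower bound of \<sigma>, so that densities below \<open>r0\<close>
    differ from \<sigma> by at least \<open>r0\<close>.\<close>
  define r0 where "r0 = c0 / 2"
  have r0: "0 < r0" using c0 by (simp add: r0_def)
  obtain l where l: "NT = Suc l" using NT by (cases NT) auto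
  have \<sigma>_ge: "2 * r0 \<le> \<sigma> (Suc k) i j" if "k < NT" "i \<in> grid" "j \<in> grid" for k i j
    using \<sigma>(6)[OF that] by (simp add: r0_def)

  \<comment> \<open>One crude bound for all values of the couplings at \<sigma>, \<open>mass\<close>
    and \<open>r0\<close>, where they do not depend on the unknown density.\<close>
  define L where "L = (\<Sum>k<NT. gsum N (\<lambda>i j. \<bar>f (real k * dt) (grid_point h i j) (\<sigma> (Suc k) i j)\<bar>
       + \<bar>f (real k * dt) (grid_point h i j) mass\<bar> + \<bar>f (real k * dt) (grid_point h i j) r0\<bar>))
     + gsum N (\<lambda>i j. \<bar>g (grid_point h i j) (\<sigma> NT i j)\<bar> + \<bar>g (grid_point h i j) mass\<bar> + \<bar>g (grid_point h i j) r0\<bar>)"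
  have Lf: "\<bar>f (real k * dt) (grid_point h i j) (\<sigma> (Suc k) i j)\<bar>
       + \<bar>f (real k * dt) (grid_point h i j) mass\<bar> + \<bar>f (real k * dt) (grid_point h i j) r0\<bar> \<le> L"
    if "k < NT" "i \<in> grid" "j \<in> grid" for k i j
  proof -
    let ?a = "\<lambda>k i j. \<bar>f (real k * dt) (grid_point h i j) (\<sigma> (Suc k) i j)\<bar>
       + \<bar>f (real k * dt) (grid_point h i j) mass\<bar> + \<bar>f (real k * dt) (grid_point h i j) r0\<bar>"
    have "?a k i j \<le> gsum N (?a k)" by (rule gsum_member_le) (use that in auto)
    also have "\<dots> \<le> (\<Sum>k<NT. gsum N (?a k))" 
      by (rule member_le_sum) (use that in \<open>auto intro!: gsum_nonneg\<close>)
    also have "\<dots> \<le> L" unfolding L_def by (simp add: gsum_nonneg)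
    finally show ?thesis .
  qed
  have Lg: "\<bar>g (grid_point h i j) (\<sigma> NT i j)\<bar> + \<bar>g (grid_point h i j) mass\<bar> + \<bar>g (grid_point h i j) r0\<bar> \<le> L"
    if "i \<in> grid" "j \<in> grid" for i j
  proof -
    let ?b = "\<lambda>i j. \<bar>g (grid_point h i j) (\<sigma> NT i j)\<bar> + \<bar>g (grid_point h i j) mass\<bar> + \<bar>g (grid_point h i j) r0\<bar>"
    have "?b i j \<le> gsum N ?b" by (rule gsum_member_le) (use that in auto)
    also have "\<dots> \<le> L" unfolding L_def by (simp add: gsum_nonneg sum_nonneg)
    finally show ?thesis .
  qed
  define Y where "Y = L * mass"
  have L0: "0 \<le> L" unfolding L_def by (intro add_nonneg_nonneg sum_nonneg gsum_nonneg) auto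
  have Y0: "0 \<le> Y" unfolding Y_def using L0 mass_pos by simp
  \<comment> \<open>The first factor adds up the lower bounds \<open>- Y\<close> of all summands in
    the energy inequality. The factor \<open>1 + 1 / dt\<close> serves the summands of
    \<open>g\<close> and, as they carry the weight \<open>dt\<close>, those of
    \<open>f\<close>.\<close>
  define Z where "Z = (dt * (real NT * ((real N)\<^sup>2 * Y)) + (real N)\<^sup>2 * Y) * (1 + 1 / dt)"
  have Z0: "0 \<le> Z" unfolding Z_def using Y0 dt by simp
  define A where "A = L + Z / r0"

  define f' where "f' \<delta> t x r = f t x (max r \<delta>)" for \<delta> t x r
  define g' where "g' \<delta> x r = g x (max r \<delta>)" for \<delta> x r
  have bounds: "\<bar>f' \<delta> (real k * dt) (grid_point h i j) (\<rho> (Suc k) i j)\<bar> \<le> A \<and> \<bar>g' \<delta> (grid_point h i j) (\<rho> NT i j)\<bar> \<le> A"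
    if \<delta>: "0 < \<delta>" "\<delta> \<le> r0" and sol: "solution (f' \<delta>) (g' \<delta>) \<phi> \<rho>" and k: "k < NT" and ij: "i \<in> grid" "j \<in> grid"
    for \<delta> \<phi> \<rho> k i j
  proof -
    define a where "a k i j = f' \<delta> (real k * dt) (grid_point h i j) (\<rho> (Suc k) i j) * (\<rho> (Suc k) i j - \<sigma> (Suc k) i j)" for k i j
    define b where "b i j = g' \<delta> (grid_point h i j) (\<rho> NT i j) * (\<rho> NT i j - \<sigma> NT i j)" for i j
    have rr: "0 \<le> \<rho> (Suc k) i j" "\<rho> (Suc k) i j \<le> mass" if "k < NT" for k i j
      using solution_pos[OF sol that, of i j] fp_solution_le_mass[OF solution_fp[OF sol], of "Suc k" i j] that by auto
    have ss: "\<sigma> (Suc k) i j \<le> mass" if "k < NT" for k i j using \<sigma>(3) that by simp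
    have a_ge: "- Y \<le> a k i j" if "k < NT" "i \<in> grid" "j \<in> grid" for k i j
      unfolding a_def f'_def Y_def
      by (rule truncation_bounds(1)[OF fm[OF that(1)] \<delta> \<sigma>_ge[OF that] ss[OF that(1)] rr[OF that(1)]])
        (use Lf[OF that] in linarith)
    have b_ge: "- Y \<le> b i j" if "i \<in> grid" "j \<in> grid" for i j
      unfolding b_def g'_def Y_def l
      by (rule truncation_bounds(1)[OF gm \<delta> \<sigma>_ge ss rr]) (use Lg[OF that] l that in auto)
    have en: "dt * (\<Sum>k<NT. gsum N (a k)) + gsum N b \<le> 0"
      unfolding a_def b_def
      by (rule energy_inequality[OF sol \<sigma>(1) \<sigma>(2)]) (simp_all add: \<sigma>(4,5) solution_initial[OF sol])
    \<comment> \<open>After adding \<open>Y\<close> all summands are nonnegative, so each is bounded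
      by the whole sum.\<close>
    have SA: "a k i j + Y \<le> (\<Sum>k<NT. gsum N (a k)) + real NT * ((real N)\<^sup>2 * Y)"
      if "k < NT" "i \<in> grid" "j \<in> grid" for k i j
    proof -
      have nn: "0 \<le> a k i j + Y" if "k < NT" "i \<in> grid" "j \<in> grid" for k i j using a_ge[OF that] by simp
      have "a k i j + Y \<le> gsum N (\<lambda>i j. a k i j + Y)"
        by (rule gsum_member_le[of N "\<lambda>i j. a k i j + Y"]) (use that nn in auto)
      also have "\<dots> \<le> (\<Sum>k<NT. gsum N (\<lambda>i j. a k i j + Y))"
        by (rule member_le_sum) (use that nn in \<open>auto intro!: gsum_nonneg\<close>)
      also have "\<dots> = (\<Sum>k<NT. gsum N (a k)) + real NT * ((real N)\<^sup>2 * Y)"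
        by (simp add: gsum_add gsum_const sum.distrib)
      finally show ?thesis .
    qed
    have SB: "b i j + Y \<le> gsum N b + (real N)\<^sup>2 * Y" if "i \<in> grid" "j \<in> grid" for i j
    proof -
      have "b i j + Y \<le> gsum N (\<lambda>i j. b i j + Y)"
      proof (rule gsum_member_le[of N "\<lambda>i j. b i j + Y"])
        show "0 \<le> b i j + Y" if "i \<in> grid" "j \<in> grid" for i j using b_ge[OF that] by simp
      qed (use that in auto)
      then show ?thesis by (simp add: gsum_add gsum_const)
    qed
    let ?X = "dt * (real NT * ((real N)\<^sup>2 * Y)) + (real N)\<^sup>2 * Y"
    have X0: "0 \<le> ?X" using Y0 dt by simp
    have SA0: "0 \<le> (\<Sum>k<NT. gsum N (a k)) + real NT * ((real N)\<^sup>2 * Y)" using SA[OF k ij] a_ge[OF k ij] by linarith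
    have SB0: "0 \<le> gsum N b + (real N)\<^sup>2 * Y" using SB[OF ij] b_ge[OF ij] by linarith
    have "dt * (a k i j + Y) \<le> dt * ((\<Sum>k<NT. gsum N (a k)) + real NT * ((real N)\<^sup>2 * Y))"
      using SA[OF k ij] dt by (intro mult_left_mono) auto
    then have "dt * (a k i j + Y) \<le> ?X" using en SB0 by (simp only: distrib_left)
    then have "a k i j + Y \<le> ?X / dt" using dt by (simp add: pos_le_divide_eq mult.commute)
    then have aZ: "a k i j \<le> Z"
      using X0 Y0 unfolding Z_def distrib_left by simp
    have "0 \<le> dt * ((\<Sum>k<NT. gsum N (a k)) + real NT * ((real N)\<^sup>2 * Y))" using SA0 dt by simp
    then have "b i j + Y \<le> ?X" using en SB[OF ij] by (simp only: distrib_left)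
    moreover have "?X \<le> Z" using X0 dt unfolding Z_def distrib_left by simp
    ultimately have bZ: "b i j \<le> Z" using Y0 by linarith
    have "\<bar>f' \<delta> (real k * dt) (grid_point h i j) (\<rho> (Suc k) i j)\<bar> \<le> L + Z / r0"
      unfolding f'_def
      by (rule truncation_bounds(2)[where B = L, OF fm[OF k] \<delta> \<sigma>_ge[OF k ij] ss[OF k] rr[OF k] _ aZ[unfolded a_def f'_def] Z0])
        (use Lf[OF k ij] in linarith)+
    moreover have "\<bar>g' \<delta> (grid_point h i j) (\<rho> NT i j)\<bar> \<le> L + Z / r0"
      unfolding g'_def l
      by (rule truncation_bounds(2)[where B = L, OF gm \<delta> \<sigma>_ge[OF _ ij] ss rr _ bZ[unfolded b_def g'_def l] Z0])
        (use Lg[OF ij] l in auto)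
    ultimately show ?thesis by (simp add: A_def)
  qed
  define M where "M = A * (1 + real NT * dt)"
  obtain c where c: "0 < c" and lower: "\<And>\<phi> \<rho> k i j. fp_solution \<phi> \<rho> \<Longrightarrow> k < NT \<Longrightarrow> (\<And>i j. \<bar>\<phi> k i j\<bar> \<le> M) \<Longrightarrow> c \<le> \<rho> (Suc k) i j"
    using fp_solution_lower_bound[of M] by blast
  \<comment> \<open>Below \<open>r0\<close> the estimates for the truncated couplings apply; below
    \<open>c\<close> the density never enters the truncated range.\<close>
  define \<delta> where "\<delta> = min r0 c"
  have \<delta>: "0 < \<delta>" "\<delta> \<le> r0" "\<delta> \<le> c" using r0 c by (auto simp: \<delta>_def)
  have trunc: "continuous_on {0..} (\<lambda>r. F (max r \<delta>))" if "continuous_on {0<..} F" for F :: "real \<Rightarrow> real"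
    by (rule continuous_on_compose2[OF that]) (use \<delta> in \<open>auto intro!: continuous_intros\<close>)
  have "\<exists>\<phi> \<rho>. solution (f' \<delta>) (g' \<delta>) \<phi> \<rho>"
    by (rule exists_solution) (simp_all add: f'_def g'_def trunc fc gc)
  then obtain \<phi> \<rho> where sol: "solution (f' \<delta>) (g' \<delta>) \<phi> \<rho>" by blast
  have \<phi>_bd: "\<bar>\<phi> k i j\<bar> \<le> M" if "k \<le> NT" for k i j
    unfolding M_def
  proof (rule hjb_maximum_principle[OF _ _ solution_hjb[OF sol] _ _ that])
    show "\<bar>f' \<delta> (real k * dt) (grid_point h i j) (\<rho> (Suc k) i j)\<bar> \<le> A"
      if "k < NT" "i \<in> grid" "j \<in> grid" for k i j
      using bounds[OF \<delta>(1,2) sol that] by simp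
    show "\<bar>\<phi> NT i j\<bar> \<le> A" if "i \<in> grid" "j \<in> grid" for i j
      using bounds[OF \<delta>(1,2) sol, of l i j] that l solution_terminal[OF sol that] by simp
  qed (use solution_periodic[OF sol] solution_pos[OF sol] in \<open>auto intro: less_imp_le\<close>)
  have \<rho>_ge: "\<delta> \<le> \<rho> (Suc k) i j" if "k < NT" for k i j
    using lower[OF solution_fp[OF sol] that, of i j] \<phi>_bd that \<delta> by (meson less_imp_le order_trans)
  have "solution f g \<phi> \<rho>"
  proof (rule solutionI[OF solution_fp[OF sol]])
    show "hjb_residual f \<phi> \<rho> k i j = 0" if "k < NT" "i \<in> grid" "j \<in> grid" for k i j
      using solution_hjb[OF sol that] \<rho>_ge[OF that(1), of i j] by (simp add: hjb_residual_def f'_def max_absorb1)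
    show "\<phi> NT i j = g (grid_point h i j) (\<rho> NT i j)" if "i \<in> grid" "j \<in> grid" for i j
      using solution_terminal[OF sol that] \<rho>_ge[of l i j] l by (simp add: g'_def max_absorb1)
    show "\<bar>\<phi> k i j\<bar> \<le> M" if "k < NT" for k i j using \<phi>_bd that by simp
  qed
  then show ?thesis by blast
qed

end

section \<open>Derivatives of convex functions\<close>

text \<open>Monotonicity comes from adding two tangent inequalities. For continuity at
  \<open>r\<close>, the derivative at \<open>y\<close> is squeezed between \<open>f r\<close> and
  the slope of the chord from \<open>y\<close> to \<open>2 * y - r\<close>, and that slope tends to
  \<open>f r\<close>.\<close>

lemma convex_derivative_mono_continuous:
  fixes F :: "real \<Rightarrow> real"
  assumes conv: "convex_on {0..} F" and deriv: "\<And>r. 0 < r \<Longrightarrow> (F has_real_derivative f r) (at r)"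
  shows "mono_on {0<..} f" and "continuous_on {0<..} f"
proof -
  have tangent: "f r * (s - r) \<le> F s - F r" if "0 < r" "0 < s" for r s
  proof (rule convex_on_imp_above_tangent[where A = "{0<..}"])
    show "convex_on {0<..} F" by (rule convex_on_subset[OF conv]) auto
    show "(F has_real_derivative f r) (at r within {0<..})"
      using deriv[OF that(1)] by (rule has_field_derivative_at_within)
  qed (use that in \<open>auto simp: interior_open\<close>)
  have mono: "f r \<le> f s" if "0 < r" "r < s" for r s
  proof -
    have "(f s - f r) * (s - r) \<ge> 0"
      using tangent[of r s] tangent[of s r] that by (simp add: algebra_simps)
    then show ?thesis using that by (simp add: zero_le_mult_iff)
  qed
  then show "mono_on {0<..} f" by (intro monotone_onI) (metis greaterThan_iff less_eq_real_def)
  show "continuous_on {0<..} f"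
  proof (rule continuous_at_imp_continuous_on, rule ballI)
    fix r :: real assume "r \<in> {0<..}"
    then have r: "0 < r" by simp
    define q where "q y = (F y - F r) / (y - r)" for y
    have q: "(q \<longlongrightarrow> f r) (at r)"
      using deriv[OF r] unfolding q_def has_field_derivative_iff by simp
    \<comment> \<open>The reflection of \<open>r\<close> in \<open>y\<close> stays different from
      \<open>r\<close>, so the limit of the difference quotient may be composed with it.\<close>
    have "filterlim (\<lambda>y. 2 * y - r) (at r) (at r)"
    proof (rule filterlim_atI)
      show "((\<lambda>y. 2 * y - r) \<longlongrightarrow> r) (at r)" by (auto intro!: tendsto_eq_intros)
      show "\<forall>\<^sub>F y in at r. 2 * y - r \<noteq> r" by (auto simp: eventually_at_filter)
    qed
    then have q2: "((\<lambda>y. q (2 * y - r)) \<longlongrightarrow> f r) (at r)" by (rule filterlim_compose[OF q])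
    have u: "((\<lambda>y. 2 * q (2 * y - r) - q y - f r) \<longlongrightarrow> 0) (at r)"
      using tendsto_diff[OF tendsto_diff[OF tendsto_mult[OF tendsto_const[of 2] q2] q] tendsto_const[of "f r"]] by simp
    \<comment> \<open>The restriction \<open>r / 2 < y\<close> keeps \<open>2 * y - r\<close>
      positive, where the tangent inequality holds.\<close>
    have bound: "\<bar>f y - f r\<bar> \<le> \<bar>2 * q (2 * y - r) - q y - f r\<bar>" if y: "r / 2 < y" "y \<noteq> r" for y
    proof -
      have e: "F (2 * y - r) - F y = (2 * q (2 * y - r) - q y) * (y - r)"
      proof -
        have "q (2 * y - r) * (2 * (y - r)) = F (2 * y - r) - F r" "q y * (y - r) = F y - F r"
          using y by (simp_all add: q_def)
        then show ?thesis by algebra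
      qed
      have t: "f y * (y - r) \<le> (2 * q (2 * y - r) - q y) * (y - r)"
        using tangent[of y "2 * y - r"] y r unfolding e by simp
      show ?thesis
      proof (cases "r < y")
        case True
        then have "f y \<le> 2 * q (2 * y - r) - q y" using t by simp
        then show ?thesis using mono[OF r True] by linarith
      next
        case False
        then have "y < r" using y by simp
        moreover from this have "2 * q (2 * y - r) - q y \<le> f y" using t by simp
        ultimately show ?thesis using mono[of y r] y r by linarith
      qed
    qed
    have "((\<lambda>y. f y - f r) \<longlongrightarrow> 0) (at r)"
    proof (rule Lim_null_comparison)
      have "\<forall>\<^sub>F y in at r. y \<in> {r / 2<..} - {r}"
        by (rule eventually_at_in_open) (use r in auto)
      then show "\<forall>\<^sub>F y in at r. norm (f y - f r) \<le> \<bar>2 * q (2 * y - r) - q y - f r\<bar>"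
        by (rule eventually_mono) (use bound in auto)
      show "((\<lambda>y. \<bar>2 * q (2 * y - r) - q y - f r\<bar>) \<longlongrightarrow> 0) (at r)"
        by (rule tendsto_rabs_zero[OF u])
    qed
    then show "isCont f r" unfolding isCont_def by (rule LIM_zero_cancel)
  qed
qed

theorem corollary2p11:
  fixes T h dt \<epsilon> \<alpha> \<beta> \<nu> :: real
    and Nh NT :: nat
    and \<rho>0 :: "real \<times> real \<Rightarrow> real"
    and F f :: "real \<Rightarrow> real \<times> real \<Rightarrow> real \<Rightarrow> real"
    and G g :: "real \<times> real \<Rightarrow> real \<Rightarrow> real"
  assumes "T > 0" and "h > 0" and "dt > 0"
    and "real Nh = 1 / h" and "real NT = T / dt"
    and "\<epsilon> > 0" and "1 < \<beta>" and "\<beta> \<le> 2" and "0 < \<alpha>" and "\<alpha> \<le> 4 * (\<beta> - 1) / \<beta>"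
    and "torus_prob_density \<rho>0"
    and "\<nu> > 0"
    and "\<And>t r. t \<in> {0..T} \<Longrightarrow> r \<ge> 0 \<Longrightarrow> torus_fun (\<lambda>x. F t x r)"
    and "\<And>r. r \<ge> 0 \<Longrightarrow> torus_fun (\<lambda>x. G x r)"
    and "\<And>t x. t \<in> {0..T} \<Longrightarrow> convex_on {0..} (F t x)"
    and "\<And>t x. t \<in> {0..T} \<Longrightarrow> continuous_on {0..} (F t x)"
    and "\<And>t x r. t \<in> {0..T} \<Longrightarrow> r > 0 \<Longrightarrow> (F t x has_real_derivative f t x r) (at r)"
    and "\<And>x. convex_on {0..} (G x)"
    and "\<And>x. continuous_on {0..} (G x)"
    and "\<And>x r. r > 0 \<Longrightarrow> (G x has_real_derivative g x r) (at r)"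
  shows "\<exists>\<phi> \<rho>. discrete_mfg_solution (congestion_hamiltonian \<epsilon> \<alpha> \<beta>) h Nh dt NT \<nu> f g \<rho>0 \<phi> \<rho>"
proof -
  have Nh: "real Nh * h = 1" using assms(2,4) by simp
  have "0 < real NT" using assms(1,3,5) by simp
  then have NT: "0 < NT" by simp
  interpret discrete_mfg "congestion_kernel \<epsilon> \<alpha> \<beta>" Nh NT h dt \<nu> \<rho>0
    by (intro discrete_mfg.intro discrete_mfg_axioms.intro hjb_congestion assms Nh NT)
  \<comment> \<open>The times at which \<open>f\<close> is evaluated lie in \<open>{0..T}\<close>,
    where the assumptions on \<open>F\<close> are available.\<close>
  have t: "real k * dt \<in> {0..T}" if "k < NT" for k
  proof -
    have "real k * dt \<le> real NT * dt" using that assms(3) by (intro mult_right_mono) auto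
    then show ?thesis using assms(3,5) by simp
  qed
  have "\<exists>\<phi> \<rho>. solution f g \<phi> \<rho>"
  proof (rule exists_solution_monotone)
    fix k i j assume "k < NT"
    note F = convex_derivative_mono_continuous[OF assms(15)[OF t[OF this]] assms(17)[OF t[OF this]]]
    show "mono_on {0<..} (f (real k * dt) (grid_point h i j))"
      and "continuous_on {0<..} (f (real k * dt) (grid_point h i j))" by (rule F, assumption)+
  next
    fix i j
    note G = convex_derivative_mono_continuous[OF assms(18) assms(20)]
    show "mono_on {0<..} (g (grid_point h i j))" and "continuous_on {0<..} (g (grid_point h i j))"
      by (rule G, assumption)+
  qed
  then show ?thesis by (simp only: congestion_hamiltonian_eq)
qed

end
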